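(* Let $\mathbb{F}$ be a field, let $\mathcal{V} \subseteq \mathbb{F}^{m \times n}$ and $\mathcal{W} \subseteq \mathbb{F}^{m \times n'}$ be rank support spaces, and let $\phi : \mathcal{V} \to \mathcal{W}$ be an $\mathbb{F}$-linear vector space isomorphism. Consider the properties: (P1) there exist full-rank matrices $A \in \mathbb{F}^{m \times m}$ and $B \in \mathbb{F}^{n \times n'}$ such that $\phi(C) = ACB$ for all $C \in \mathcal{V}$; (P2) a subspace $\mathcal{U} \subseteq \mathcal{V}$ is a rank support space if and only if $\phi(\mathcal{U})$ is a rank support space; (P3) for every subspace $\mathcal{D} \subseteq \mathcal{V}$, ${\rm wt_R}(\phi(\mathcal{D})) = {\rm wt_R}(\mathcal{D})$; (P4) ${\rm Rk}(\phi(V)) = {\rm Rk}(V)$ for all $V \in \mathcal{V}$ (i.e. $\phi$ is a rank isometry). Then (P1) $\Leftrightarrow$ (P2) $\Leftrightarrow$ (P3) $\Rightarrow$ (P4). Moreover, in the case $\mathcal{V} = \mathcal{W} = \mathbb{F}^{m \times n}$ (so $n'=n$) and $m \neq n$, (P4) implies (P1) as well.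
   Context: For $C \in \mathbb{F}^{m\times n}$, ${\rm Row}(C) \subseteq \mathbb{F}^n$ is the row space and ${\rm Rk}(C) = \dim {\rm Row}(C)$. For a subspace $\mathcal{D} \subseteq \mathbb{F}^{m \times n}$, its rank support is ${\rm RSupp}(\mathcal{D}) = \sum_{C \in \mathcal{D}} {\rm Row}(C) \subseteq \mathbb{F}^n$ and its rank weight is ${\rm wt_R}(\mathcal{D}) = \dim {\rm RSupp}(\mathcal{D})$. For a subspace $\mathcal{L} \subseteq \mathbb{F}^n$, $\mathcal{V}_\mathcal{L} = \{V \in \mathbb{F}^{m\times n} \mid {\rm Row}(V) \subseteq \mathcal{L}\}$; a rank support space in $\mathbb{F}^{m \times n}$ is a set of the form $\mathcal{V}_\mathcal{L}$ for some subspace $\mathcal{L} \subseteq \mathbb{F}^n$ (analogously in $\mathbb{F}^{m\times n'}$). *)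

theory Defs
  imports "Jordan_Normal_Form.VS_Connect"
begin

definition subspace_vec :: "nat \<Rightarrow> 'a::field vec set \<Rightarrow> bool" where
  "subspace_vec k L \<longleftrightarrow> subspace (class_ring :: 'a ring) L (module_vec TYPE('a) k)"

definition subspace_mat :: "nat \<Rightarrow> nat \<Rightarrow> 'a::field mat set \<Rightarrow> bool" where
  "subspace_mat m n D \<longleftrightarrow> subspace (class_ring :: 'a ring) D (module_mat TYPE('a) m n)"

definition dim_vec :: "nat \<Rightarrow> 'a::field vec set \<Rightarrow> nat" where
  "dim_vec k L = vectorspace.dim (class_ring :: 'a ring) ((module_vec TYPE('a) k)\<lparr>carrier := L\<rparr>)"

definition span_vec :: "nat \<Rightarrow> 'a::field vec set \<Rightarrow> 'a vec set" where
  "span_vec k S = LinearCombinations.module.span (class_ring :: 'a ring) (module_vec TYPE('a) k) S"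

definition Row :: "'a::field mat \<Rightarrow> 'a vec set" where
  "Row C = span_vec (dim_col C) (set (rows C))"

definition Rk :: "'a::field mat \<Rightarrow> nat" where
  "Rk C = dim_vec (dim_col C) (Row C)"

definition RSupp :: "nat \<Rightarrow> 'a::field mat set \<Rightarrow> 'a vec set" where
  "RSupp n D = span_vec n (\<Union>C\<in>D. Row C)"

definition wtR :: "nat \<Rightarrow> 'a::field mat set \<Rightarrow> nat" where
  "wtR n D = dim_vec n (RSupp n D)"

definition VL :: "nat \<Rightarrow> nat \<Rightarrow> 'a::field vec set \<Rightarrow> 'a mat set" where
  "VL m n L = {V \<in> carrier_mat m n. Row V \<subseteq> L}"

definition rank_support_space :: "nat \<Rightarrow> nat \<Rightarrow> 'a::field mat set \<Rightarrow> bool" where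
  "rank_support_space m n D \<longleftrightarrow> (\<exists>L. subspace_vec n L \<and> D = VL m n L)"

end

theory Submission
  imports Defs "Jordan_Normal_Form.DL_Rank"
begin

text \<open>
  Write \<open>u \<otimes> v\<close> for the matrix \<open>outer u v\<close>. The sets \<open>{u \<otimes> v | u}\<close> with \<open>v \<noteq> 0\<close> are the minimal
  nonzero rank support spaces, and the pivot is the property that \<open>\<phi>\<close> maps each of them into a
  set \<open>{u \<otimes> w | u}\<close> (\<open>preserves_lines\<close>). P2 implies it by minimality, and P3 because these sets
  have weight at most one. Conversely, fix \<open>v\<^sub>0 \<noteq> 0\<close> in \<open>L\<close> and write \<open>\<phi> (u \<otimes> v\<^sub>0) = A u \<otimes> w\<^sub>0\<close>.
  Comparing the images of \<open>u \<otimes> v\<^sub>0\<close>, \<open>u \<otimes> v\<close> and \<open>u \<otimes> (v\<^sub>0 + v)\<close> gives \<open>\<phi> (u \<otimes> v) = A u \<otimes> f v\<close> with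
  the same \<open>A\<close>, where \<open>f\<close> is linear and injective; extending \<open>f\<close> to a map of full rank yields \<open>B\<close>.

  A rank isometry maps \<open>{u \<otimes> v | u}\<close> to a space of matrices of rank at most one. In such a space
  either all row spaces or all column spaces lie in a common line, and for \<open>m > n\<close> the second case
  is excluded by dimension. For \<open>m < n\<close> one transposes.
\<close>

section \<open>Subspaces and spans\<close>

lemma subspace_vec_iff:
  "subspace_vec k L \<longleftrightarrow> L \<subseteq> carrier_vec k \<and> 0\<^sub>v k \<in> L \<and>
     (\<forall>x\<in>L. \<forall>y\<in>L. x + y \<in> L) \<and> (\<forall>c. \<forall>x\<in>L. c \<cdot>\<^sub>v x \<in> L)"
  using vec_vs vec_module
  by (auto simp: subspace_vec_def subspace_def submodule_def module_vec_simps class_ring_simps)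

lemma subspace_mat_iff:
  "subspace_mat m n D \<longleftrightarrow> D \<subseteq> carrier_mat m n \<and> 0\<^sub>m m n \<in> D \<and>
     (\<forall>x\<in>D. \<forall>y\<in>D. x + y \<in> D) \<and> (\<forall>c. \<forall>x\<in>D. c \<cdot>\<^sub>m x \<in> D)"
  using matrix_vs[of m n]
  by (auto simp: subspace_mat_def subspace_def submodule_def module_mat_simps class_ring_simps
      vectorspace_def)

lemma subspace_vecD:
  assumes "subspace_vec k L"
  shows subspace_vec_subset_carrier: "L \<subseteq> carrier_vec k"
    and subspace_vec_carrierD: "x \<in> L \<Longrightarrow> x \<in> carrier_vec k"
    and subspace_vec_zero: "0\<^sub>v k \<in> L"
    and subspace_vec_add: "x \<in> L \<Longrightarrow> y \<in> L \<Longrightarrow> x + y \<in> L"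
    and subspace_vec_smult: "x \<in> L \<Longrightarrow> c \<cdot>\<^sub>v x \<in> L"
  using assms by (auto simp: subspace_vec_iff)

lemma subspace_matD:
  assumes "subspace_mat m n D"
  shows subspace_mat_subset_carrier: "D \<subseteq> carrier_mat m n"
    and subspace_mat_zero: "0\<^sub>m m n \<in> D"
    and subspace_mat_add: "C \<in> D \<Longrightarrow> C' \<in> D \<Longrightarrow> C + C' \<in> D"
    and subspace_mat_smult: "C \<in> D \<Longrightarrow> c \<cdot>\<^sub>m C \<in> D"
  using assms by (auto simp: subspace_mat_iff)

lemma smult_zero_vec [simp]: "(c :: 'a::field) \<cdot>\<^sub>v 0\<^sub>v n = 0\<^sub>v n"
  by (intro eq_vecI) auto

lemma subspace_carrier_vec: "subspace_vec k (carrier_vec k)"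
  by (auto simp: subspace_vec_iff)

lemma subspace_zero_vec: "subspace_vec k {0\<^sub>v k}"
  by (auto simp: subspace_vec_iff)

lemma span_vec_superset:
  assumes "S \<subseteq> carrier_vec k"
  shows "S \<subseteq> span_vec k S"
proof -
  interpret vec_space "TYPE('a)" k .
  show ?thesis unfolding span_vec_def using in_own_span assms by simp
qed

lemma subspace_span_vec:
  assumes "S \<subseteq> carrier_vec k"
  shows "subspace_vec k (span_vec k S)"
proof -
  interpret vec_space "TYPE('a)" k .
  show ?thesis unfolding span_vec_def subspace_vec_def using span_is_subspace assms by simp
qed

lemma span_vec_least:
  assumes "S \<subseteq> L" and "subspace_vec k L"
  shows "span_vec k S \<subseteq> L"
proof -
  interpret vec_space "TYPE('a)" k .
  show ?thesis
    using span_is_subset[of S L] assms unfolding span_vec_def subspace_vec_def by simp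
qed

lemma span_vec_eqI:
  assumes "subspace_vec k L" "S \<subseteq> L" "\<And>L'. subspace_vec k L' \<Longrightarrow> S \<subseteq> L' \<Longrightarrow> L \<subseteq> L'"
  shows "span_vec k S = L"
proof
  have S: "S \<subseteq> carrier_vec k" using assms(1,2) subspace_vec_subset_carrier by blast
  show "L \<subseteq> span_vec k S" by (rule assms(3)[OF subspace_span_vec[OF S] span_vec_superset[OF S]])
qed (rule span_vec_least[OF assms(2,1)])

section \<open>Linear maps on subspaces\<close>

definition linear_vec_on :: "'a::field vec set \<Rightarrow> nat \<Rightarrow> ('a vec \<Rightarrow> 'a vec) \<Rightarrow> bool" where
  "linear_vec_on L r f \<longleftrightarrow> (\<forall>x\<in>L. f x \<in> carrier_vec r) \<and>
     (\<forall>x\<in>L. \<forall>y\<in>L. f (x + y) = f x + f y) \<and> (\<forall>c. \<forall>x\<in>L. f (c \<cdot>\<^sub>v x) = c \<cdot>\<^sub>v f x)"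

lemma linear_vec_onI:
  assumes "\<And>x. x \<in> L \<Longrightarrow> f x \<in> carrier_vec r"
    and "\<And>x y. x \<in> L \<Longrightarrow> y \<in> L \<Longrightarrow> f (x + y) = f x + f y"
    and "\<And>c x. x \<in> L \<Longrightarrow> f (c \<cdot>\<^sub>v x) = c \<cdot>\<^sub>v f x"
  shows "linear_vec_on L r f"
  using assms by (auto simp: linear_vec_on_def)

lemma linear_vec_onD:
  assumes "linear_vec_on L r f"
  shows linear_vec_on_carrier: "x \<in> L \<Longrightarrow> f x \<in> carrier_vec r"
    and linear_vec_on_add: "x \<in> L \<Longrightarrow> y \<in> L \<Longrightarrow> f (x + y) = f x + f y"
    and linear_vec_on_smult: "x \<in> L \<Longrightarrow> f (c \<cdot>\<^sub>v x) = c \<cdot>\<^sub>v f x"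
  using assms by (auto simp: linear_vec_on_def)

lemma linear_vec_on_zero:
  assumes "subspace_vec k L" and "linear_vec_on L r f"
  shows "f (0\<^sub>v k) = 0\<^sub>v r"
proof -
  have "f (0 \<cdot>\<^sub>v 0\<^sub>v k) = 0 \<cdot>\<^sub>v f (0\<^sub>v k)"
    using linear_vec_on_smult[OF assms(2) subspace_vec_zero[OF assms(1)]] .
  also have "\<dots> = 0\<^sub>v r"
    using linear_vec_on_carrier[OF assms(2) subspace_vec_zero[OF assms(1)]] by auto
  finally show ?thesis by simp
qed

lemma linear_vec_on_mult_mat_vec:
  assumes "A \<in> carrier_mat r k" "L \<subseteq> carrier_vec k"
  shows "linear_vec_on L r (\<lambda>x. A *\<^sub>v x)"
  using assms mult_add_distrib_mat_vec[OF assms(1)] mult_mat_vec[OF assms(1)]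
  by (intro linear_vec_onI) (simp_all add: subset_iff)

lemma linear_vec_on_subset: "linear_vec_on L r f \<Longrightarrow> L' \<subseteq> L \<Longrightarrow> linear_vec_on L' r f"
  unfolding linear_vec_on_def by blast

lemma subspace_vec_image:
  assumes L: "subspace_vec k L" and f: "linear_vec_on L r f"
  shows "subspace_vec r (f ` L)"
  unfolding subspace_vec_iff
proof (intro conjI ballI allI)
  show "f ` L \<subseteq> carrier_vec r" using linear_vec_on_carrier[OF f] by blast
  show "0\<^sub>v r \<in> f ` L"
    using linear_vec_on_zero[OF L f] subspace_vec_zero[OF L] by (metis imageI)
  show "x + y \<in> f ` L" if "x \<in> f ` L" "y \<in> f ` L" for x y
    using that linear_vec_on_add[OF f] subspace_vec_add[OF L]
    by (metis (no_types, lifting) imageE imageI)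
  show "c \<cdot>\<^sub>v x \<in> f ` L" if "x \<in> f ` L" for c x
    using that linear_vec_on_smult[OF f] subspace_vec_smult[OF L]
    by (metis (no_types, lifting) imageE imageI)
qed

lemma subspace_vec_vimage:
  assumes L: "subspace_vec k L" and f: "linear_vec_on L r f" and S: "subspace_vec r S"
  shows "subspace_vec k {x \<in> L. f x \<in> S}"
  using subspace_vecD[OF L] subspace_vecD[OF S] linear_vec_on_zero[OF L f] linear_vec_onD[OF f]
  by (auto simp: subspace_vec_iff)

lemma span_vec_image:
  assumes L: "subspace_vec k L" and f: "linear_vec_on L r f" and S: "S \<subseteq> L"
  shows "span_vec r (f ` S) = f ` span_vec k S"
proof (rule span_vec_eqI)
  have Sk: "S \<subseteq> carrier_vec k" using S subspace_vec_subset_carrier[OF L] by blast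
  have f_span: "linear_vec_on (span_vec k S) r f"
    using linear_vec_on_subset[OF f span_vec_least[OF S L]] .
  show "subspace_vec r (f ` span_vec k S)"
    using subspace_vec_image[OF subspace_span_vec[OF Sk] f_span] .
  show "f ` S \<subseteq> f ` span_vec k S" using span_vec_superset[OF Sk] by blast
  fix L' assume L': "subspace_vec r L'" "f ` S \<subseteq> L'"
  have "span_vec k S \<subseteq> {x \<in> L. f x \<in> L'}"
    using L'(2) S by (intro span_vec_least[OF _ subspace_vec_vimage[OF L f L'(1)]]) blast
  then show "f ` span_vec k S \<subseteq> L'" by blast
qed

lemma linear_vec_on_span_eqI:
  assumes f: "linear_vec_on (span_vec k S) r f" and g: "linear_vec_on (span_vec k S) r g"
    and S: "S \<subseteq> carrier_vec k" and eq: "\<And>x. x \<in> S \<Longrightarrow> f x = g x" and x: "x \<in> span_vec k S"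
  shows "f x = g x"
proof -
  note L = subspace_span_vec[OF S]
  have "subspace_vec k {x \<in> span_vec k S. f x = g x}"
    using subspace_vecD[OF L] linear_vec_onD[OF f] linear_vec_onD[OF g]
      linear_vec_on_zero[OF L f] linear_vec_on_zero[OF L g]
    by (auto simp: subspace_vec_iff)
  then have "span_vec k S \<subseteq> {x \<in> span_vec k S. f x = g x}"
    using span_vec_superset[OF S] eq by (intro span_vec_least) auto
  then show ?thesis using x by blast
qed

section \<open>Bases and dimension\<close>

definition lin_indpt_list :: "nat \<Rightarrow> 'a::field vec list \<Rightarrow> bool" where
  "lin_indpt_list k xs \<longleftrightarrow> set xs \<subseteq> carrier_vec k \<and> distinct xs \<and>
     module.lin_indpt (class_ring :: 'a ring) (module_vec TYPE('a) k) (set xs)"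

lemma lin_indpt_list_carrier: "lin_indpt_list k xs \<Longrightarrow> set xs \<subseteq> carrier_vec k"
  by (simp add: lin_indpt_list_def)

lemma lin_indpt_list_Nil [simp]: "lin_indpt_list k []"
proof -
  interpret vec_space "TYPE('a)" k .
  show "lin_indpt_list k ([] :: 'a vec list)" by (simp add: lin_indpt_list_def lin_dep_def)
qed

lemma lin_indpt_list_Cons:
  "lin_indpt_list k (x # xs) \<longleftrightarrow>
     x \<in> carrier_vec k \<and> x \<notin> span_vec k (set xs) \<and> lin_indpt_list k xs"
proof -
  interpret vec_space "TYPE('a)" k .
  show ?thesis
    using lin_dep_iff_in_span[of "set xs" x] span_vec_superset[of "set xs" k]
      subset_li_is_li[of "set (x # xs)" "set xs"]
    by (auto simp: lin_indpt_list_def span_vec_def)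
qed

lemma lin_indpt_list_appendD: "lin_indpt_list k (xs @ ys) \<Longrightarrow> lin_indpt_list k ys"
  by (induction xs) (auto simp: lin_indpt_list_Cons)

lemma lin_indpt_list_map:
  assumes L: "subspace_vec k L" and f: "linear_vec_on L r f" and inj: "inj_on f L"
    and "lin_indpt_list k xs" "set xs \<subseteq> L"
  shows "lin_indpt_list r (map f xs)"
  using assms(4,5)
proof (induction xs)
  case (Cons x xs)
  have "f x \<notin> span_vec r (f ` set xs)"
    using Cons.prems span_vec_least[OF _ L, of "set xs"] inj
    by (auto simp: span_vec_image[OF L f] lin_indpt_list_Cons inj_on_image_mem_iff)
  then show ?case
    using Cons linear_vec_on_carrier[OF f] by (auto simp: lin_indpt_list_Cons)
qed simp

lemma dim_span_lin_indpt_list: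
  fixes xs :: "'a::field vec list"
  assumes "lin_indpt_list k xs"
  shows "dim_vec k (span_vec k (set xs)) = length xs"
proof -
  interpret vec_space "TYPE('a)" k .
  have "maximal (set xs) (\<lambda>T. T \<subseteq> set xs \<and> lin_indpt T)"
    using assms by (auto simp: lin_indpt_list_def maximal_def)
  then have "dim_vec k (span_vec k (set xs)) = card (set xs)"
    using assms dim_span[of "set xs" "set xs"]
    by (auto simp: lin_indpt_list_def dim_vec_def span_vec_def)
  then show ?thesis using assms by (simp add: lin_indpt_list_def distinct_card)
qed

lemma length_lin_indpt_list_le:
  fixes xs :: "'a::field vec list"
  assumes "lin_indpt_list k xs"
  shows "length xs \<le> k"
proof -
  interpret vec_space "TYPE('a)" k .
  show ?thesis
    using assms li_le_dim(2)[of "set xs"] by (simp add: lin_indpt_list_def distinct_card dim_is_n)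
qed

lemma extend_lin_indpt_list:
  assumes L: "subspace_vec k L" and "lin_indpt_list k xs" "set xs \<subseteq> L"
  obtains ys where "lin_indpt_list k (ys @ xs)" "span_vec k (set (ys @ xs)) = L"
proof -
  have "\<exists>ys. lin_indpt_list k (ys @ xs) \<and> span_vec k (set (ys @ xs)) = L"
    using assms(2,3)
  proof (induction "k - length xs" arbitrary: xs rule: less_induct)
    case less
    show ?case
    proof (cases "span_vec k (set xs) = L")
      case True
      then show ?thesis using less.prems by (intro exI[of _ "[]"]) simp
    next
      case False
      then obtain x where x: "x \<in> L" "x \<notin> span_vec k (set xs)"
        using span_vec_least[OF less.prems(2) L] by blast
      then have indpt: "lin_indpt_list k (x # xs)"
        using less.prems(1) subspace_vec_carrierD[OF L] by (simp add: lin_indpt_list_Cons)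
      moreover have "k - length (x # xs) < k - length xs"
        using length_lin_indpt_list_le[OF indpt] by simp
      ultimately obtain ys where
        "lin_indpt_list k (ys @ x # xs)" "span_vec k (set (ys @ x # xs)) = L"
        using less.hyps[of "x # xs"] less.prems(2) x(1) by auto
      then show ?thesis by (intro exI[of _ "ys @ [x]"]) simp
    qed
  qed
  then show ?thesis using that by blast
qed

lemma ex_basis_list:
  assumes "subspace_vec k L"
  obtains xs where "lin_indpt_list k xs" "span_vec k (set xs) = L"
  using extend_lin_indpt_list[OF assms lin_indpt_list_Nil] by auto

lemma lin_indpt_unit_vecs: "lin_indpt_list k (unit_vecs k :: 'a::field vec list)"
  and span_unit_vecs: "span_vec k (set (unit_vecs k :: 'a vec list)) = carrier_vec k"
proof -
  interpret vec_space "TYPE('a)" k .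
  show "lin_indpt_list k (unit_vecs k :: 'a vec list)"
    using unit_vecs_basis unit_vecs_distinct by (simp add: lin_indpt_list_def basis_def)
  show "span_vec k (set (unit_vecs k :: 'a vec list)) = carrier_vec k"
    using span_unit_vecs_is_carrier by (simp add: span_vec_def)
qed

lemma dim_carrier_vec: "dim_vec k (carrier_vec k :: 'a::field vec set) = k"
proof -
  have "dim_vec k (carrier_vec k :: 'a vec set) = length (unit_vecs k :: 'a vec list)"
    using dim_span_lin_indpt_list[OF lin_indpt_unit_vecs] unfolding span_unit_vecs .
  then show ?thesis by (simp add: unit_vecs_def)
qed

lemma dim_vec_le:
  assumes "subspace_vec k L"
  shows "dim_vec k L \<le> k"
  using ex_basis_list[OF assms] dim_span_lin_indpt_list length_lin_indpt_list_le by metis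

lemma dim_vec_image:
  assumes L: "subspace_vec k L" and f: "linear_vec_on L r f" and inj: "inj_on f L"
  shows "dim_vec r (f ` L) = dim_vec k L"
proof -
  obtain xs where xs: "lin_indpt_list k xs" "span_vec k (set xs) = L" using ex_basis_list[OF L] .
  have sub: "set xs \<subseteq> L" using span_vec_superset lin_indpt_list_carrier[OF xs(1)] xs(2) by blast
  have "f ` L = span_vec r (set (map f xs))" using span_vec_image[OF L f sub] xs(2) by simp
  then show ?thesis
    using dim_span_lin_indpt_list[OF lin_indpt_list_map[OF L f inj xs(1) sub]]
      dim_span_lin_indpt_list[OF xs(1)] xs(2) by simp
qed

lemma extend_to_basis_list:
  fixes xs :: "'a::field vec list"
  assumes xs: "lin_indpt_list k xs"
  obtains ys where "lin_indpt_list k (ys @ xs)" "length (ys @ xs) = k"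
    "span_vec k (set (ys @ xs)) = carrier_vec k"
proof -
  obtain ys where ys: "lin_indpt_list k (ys @ xs)" "span_vec k (set (ys @ xs)) = carrier_vec k"
    using extend_lin_indpt_list[OF subspace_carrier_vec xs lin_indpt_list_carrier[OF xs]] .
  moreover have "length (ys @ xs) = k"
    using dim_span_lin_indpt_list[OF ys(1)] unfolding ys(2) dim_carrier_vec by simp
  ultimately show ?thesis by (intro that)
qed

lemma extend_lin_indpt_list_length:
  assumes xs: "lin_indpt_list k xs" and p: "length xs \<le> p" "p \<le> k"
  obtains ys where "lin_indpt_list k (ys @ xs)" "length (ys @ xs) = p"
proof -
  obtain zs where zs: "lin_indpt_list k (zs @ xs)" "length (zs @ xs) = k"
    using extend_to_basis_list[OF xs] .
  let ?j = "k - p"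
  have "zs @ xs = take ?j zs @ drop ?j zs @ xs" by simp
  then have "lin_indpt_list k (drop ?j zs @ xs)" using zs(1) lin_indpt_list_appendD by metis
  moreover have "length (drop ?j zs @ xs) = p" using zs(2) p by simp
  ultimately show ?thesis by (rule that)
qed

lemma mult_mat_of_cols:
  assumes A: "A \<in> carrier_mat r k" and xs: "set xs \<subseteq> carrier_vec k"
  shows "A * mat_of_cols k xs = mat_of_cols r (map (\<lambda>x. A *\<^sub>v x) xs)"
proof (rule mat_col_eqI)
  have X: "mat_of_cols k xs \<in> carrier_mat k (length xs)" by simp
  fix j assume "j < dim_col (mat_of_cols r (map (\<lambda>x. A *\<^sub>v x) xs))"
  then have j: "j < length xs" by simp
  then have "xs ! j \<in> carrier_vec k" using xs by auto
  then show "col (A * mat_of_cols k xs) j = col (mat_of_cols r (map (\<lambda>x. A *\<^sub>v x) xs)) j"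
    using j A col_mult2[OF A X j] by simp
qed (use A in auto)

lemma mat_of_cols_inject:
  assumes "mat_of_cols r xs = mat_of_cols r ys" "set xs \<subseteq> carrier_vec r" "set ys \<subseteq> carrier_vec r"
  shows "xs = ys"
  using arg_cong[OF assms(1), of cols] assms(2,3) by simp

lemma ex_mat_mapping_basis_list:
  fixes xs :: "'a::field vec list"
  assumes xs: "lin_indpt_list k xs" "length xs = k" and ys: "set ys \<subseteq> carrier_vec r" "length ys = k"
  obtains A where "A \<in> carrier_mat r k" "map (\<lambda>x. A *\<^sub>v x) xs = ys"
proof -
  interpret vec_space "TYPE('a)" k .
  have P: "mat_of_cols k xs \<in> carrier_mat k k" and C: "mat_of_cols r ys \<in> carrier_mat r k"
    using xs(2) ys(2) by auto
  have "det (mat_of_cols k xs) \<noteq> 0"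
    using xs lin_indpt_full_rank[OF P] by (simp add: det_rank_iff[OF P] lin_indpt_list_def)
  then obtain Q where Q: "Q \<in> carrier_mat k k" "Q * mat_of_cols k xs = 1\<^sub>m k"
    using det_non_zero_imp_unit[OF P] by (auto simp: Units_def ring_mat_simps)
  have A: "mat_of_cols r ys * Q \<in> carrier_mat r k" using C Q(1) by simp
  have "mat_of_cols r ys * Q * mat_of_cols k xs = mat_of_cols r ys"
    using C by (simp add: assoc_mult_mat[OF C Q(1) P] Q(2) right_mult_one_mat[OF C])
  then have "mat_of_cols r (map (\<lambda>x. (mat_of_cols r ys * Q) *\<^sub>v x) xs) = mat_of_cols r ys"
    using mult_mat_of_cols[OF A lin_indpt_list_carrier[OF xs(1)]] by simp
  then have "map (\<lambda>x. (mat_of_cols r ys * Q) *\<^sub>v x) xs = ys"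
    by (rule mat_of_cols_inject) (use A lin_indpt_list_carrier[OF xs(1)] ys(1) in auto)
  with A show ?thesis by (rule that)
qed

lemma ex_mat_mapping_lin_indpt_list:
  fixes xs :: "'a::field vec list"
  assumes xs: "lin_indpt_list k xs" and ys: "set ys \<subseteq> carrier_vec r" "length ys = length xs"
  obtains A where "A \<in> carrier_mat r k" "map (\<lambda>x. A *\<^sub>v x) xs = ys"
    "(\<lambda>x. A *\<^sub>v x) ` carrier_vec k = span_vec r (set ys)"
proof -
  obtain zs where zs: "lin_indpt_list k (zs @ xs)" "length (zs @ xs) = k"
    "span_vec k (set (zs @ xs)) = carrier_vec k" using extend_to_basis_list[OF xs] .
  define ws where "ws = map (\<lambda>_. 0\<^sub>v r) zs @ ys"
  have ws: "set ws \<subseteq> carrier_vec r" "length ws = k" using zs(2) ys by (auto simp: ws_def)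
  obtain A where A: "A \<in> carrier_mat r k" "map (\<lambda>x. A *\<^sub>v x) (zs @ xs) = ws"
    using ex_mat_mapping_basis_list[OF zs(1,2) ws] .
  have "(\<lambda>x. A *\<^sub>v x) ` carrier_vec k = span_vec r ((\<lambda>x. A *\<^sub>v x) ` set (zs @ xs))"
    using span_vec_image[OF subspace_carrier_vec linear_vec_on_mult_mat_vec[OF A(1) order_refl]
        lin_indpt_list_carrier[OF zs(1)]] zs(3) by simp
  also have "(\<lambda>x. A *\<^sub>v x) ` set (zs @ xs) = set ws" using A(2) by (metis list.set_map)
  also have "span_vec r (set ws) = span_vec r (set ys)"
    using span_vec_superset[OF ys(1)] subspace_vec_zero[OF subspace_span_vec[OF ys(1)]]
      span_vec_superset[OF ws(1)]
    by (intro equalityI span_vec_least subspace_span_vec ws(1) ys(1)) (auto simp: ws_def)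
  finally show ?thesis using that[of A] A ys(2) by (simp add: ws_def)
qed

section \<open>Lines\<close>

definition line :: "'a::field vec \<Rightarrow> 'a vec set" where
  "line v = range (\<lambda>c. c \<cdot>\<^sub>v v)"

lemma in_line_iff: "x \<in> line v \<longleftrightarrow> (\<exists>c. x = c \<cdot>\<^sub>v v)"
  by (auto simp: line_def)

lemma smult_in_line [simp]: "c \<cdot>\<^sub>v v \<in> line v"
  by (simp add: line_def)

lemma self_in_line [simp]: "v \<in> line v"
  unfolding line_def by (rule range_eqI[of _ _ 1]) simp

lemma line_zero: "line (0\<^sub>v k) = {0\<^sub>v k}"
  by (auto simp: line_def)

lemma line_subset: "subspace_vec k L \<Longrightarrow> v \<in> L \<Longrightarrow> line v \<subseteq> L"
  by (auto simp: line_def subspace_vec_smult)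

lemma subspace_line:
  assumes "v \<in> carrier_vec k"
  shows "subspace_vec k (line v)"
  unfolding subspace_vec_iff
proof (intro conjI ballI allI)
  show "line v \<subseteq> carrier_vec k" using assms by (auto simp: line_def)
  have "0\<^sub>v k = 0 \<cdot>\<^sub>v v" using assms by auto
  then show "0\<^sub>v k \<in> line v" by simp
  show "x + y \<in> line v" if "x \<in> line v" "y \<in> line v" for x y
    using that by (auto simp: line_def simp flip: add_smult_distrib_vec)
  show "c \<cdot>\<^sub>v x \<in> line v" if "x \<in> line v" for c x
    using that by (auto simp: line_def smult_smult_assoc)
qed

lemma span_vec_singleton: "v \<in> carrier_vec k \<Longrightarrow> span_vec k {v} = line v"
  by (intro span_vec_eqI subspace_line line_subset) auto

lemma span_vec_empty: "span_vec k {} = {0\<^sub>v k}"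
  by (intro span_vec_eqI subspace_zero_vec) (auto simp: subspace_vec_zero)

lemma line_smult:
  assumes "c \<noteq> 0"
  shows "line (c \<cdot>\<^sub>v v) = line v"
proof -
  have "a \<cdot>\<^sub>v v = (a / c) \<cdot>\<^sub>v (c \<cdot>\<^sub>v v)" for a using assms by (simp add: smult_smult_assoc)
  then have "a \<cdot>\<^sub>v v \<in> line (c \<cdot>\<^sub>v v)" for a by (metis smult_in_line)
  then show ?thesis by (auto simp: line_def smult_smult_assoc)
qed

lemma line_eq:
  assumes "v \<in> carrier_vec k" "x \<in> line v" "x \<noteq> 0\<^sub>v k"
  shows "line x = line v"
proof -
  obtain c where c: "x = c \<cdot>\<^sub>v v" using assms(2) by (auto simp: line_def)
  then have "c \<noteq> 0" using assms(1,3) by auto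
  then show ?thesis unfolding c by (rule line_smult)
qed

lemma subspace_subset_line:
  assumes S: "subspace_vec k S" and sub: "S \<subseteq> line v" and v: "v \<in> carrier_vec k"
  shows "S = {0\<^sub>v k} \<or> S = line v"
proof (cases "S \<subseteq> {0\<^sub>v k}")
  case True
  then show ?thesis using subspace_vec_zero[OF S] by auto
next
  case False
  then obtain x where x: "x \<in> S" "x \<noteq> 0\<^sub>v k" by blast
  then have "line v \<subseteq> S" using line_eq[OF v] line_subset[OF S x(1)] sub by blast
  then show ?thesis using sub by blast
qed

lemma dim_vec_zero: "dim_vec k {0\<^sub>v k :: 'a::field vec} = 0"
  using dim_span_lin_indpt_list[OF lin_indpt_list_Nil[where 'a = 'a]] by (simp add: span_vec_empty)

lemma dim_line_le:
  assumes "v \<in> carrier_vec k"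
  shows "dim_vec k (line v) \<le> 1"
proof (cases "v = 0\<^sub>v k")
  case True
  then show ?thesis by (simp add: line_zero dim_vec_zero)
next
  case False
  then have "lin_indpt_list k [v]" using assms by (simp add: lin_indpt_list_Cons span_vec_empty)
  from dim_span_lin_indpt_list[OF this] show ?thesis using assms by (simp add: span_vec_singleton)
qed

lemma dim_vec_le_1_iff:
  assumes S: "subspace_vec k S"
  shows "dim_vec k S \<le> 1 \<longleftrightarrow> (\<exists>v\<in>carrier_vec k. S \<subseteq> line v)"
proof
  assume dim: "dim_vec k S \<le> 1"
  obtain xs where xs: "lin_indpt_list k xs" "span_vec k (set xs) = S" using ex_basis_list[OF S] .
  have "length xs \<le> 1" using dim dim_span_lin_indpt_list[OF xs(1)] xs(2) by simp
  then consider (empty) "xs = []" | (singleton) v where "xs = [v]" by (cases xs) auto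
  then show "\<exists>v\<in>carrier_vec k. S \<subseteq> line v"
  proof cases
    case empty
    then show ?thesis
      using xs(2) by (intro bexI[of _ "0\<^sub>v k"]) (auto simp: span_vec_empty line_zero)
  next
    case singleton
    then have "v \<in> carrier_vec k" using lin_indpt_list_carrier[OF xs(1)] by simp
    then show ?thesis using singleton xs(2) by (auto simp: span_vec_singleton)
  qed
next
  assume "\<exists>v\<in>carrier_vec k. S \<subseteq> line v"
  then obtain v where v: "v \<in> carrier_vec k" "S \<subseteq> line v" by blast
  then have "S = {0\<^sub>v k} \<or> S = line v" by (intro subspace_subset_line[OF S])
  then show "dim_vec k S \<le> 1" using dim_line_le[OF v(1)] by (auto simp: dim_vec_zero)
qed

section \<open>Row spaces and rank supports\<close>

lemma Row_eq_image:
  assumes "C \<in> carrier_mat m n"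
  shows "Row C = (\<lambda>y. C\<^sup>T *\<^sub>v y) ` carrier_vec m"
proof -
  interpret vec_space "TYPE('a)" n .
  have "Row C = row_space C"
    using assms by (auto simp: Row_def span_vec_def row_space_def)
  also have "\<dots> = (\<lambda>y. C\<^sup>T *\<^sub>v y) ` carrier_vec m"
    using row_space_eq[OF assms] assms by (auto simp: image_def)
  finally show ?thesis .
qed

lemma subspace_Row:
  assumes "C \<in> carrier_mat m n"
  shows "subspace_vec n (Row C)"
  unfolding Row_def using assms subspace_span_vec[of "set (rows C)"] rows_carrier[of C] by auto

lemma Row_subset_iff:
  assumes C: "C \<in> carrier_mat m n" and L: "subspace_vec n L"
  shows "Row C \<subseteq> L \<longleftrightarrow> (\<forall>i<m. row C i \<in> L)"
proof -
  have "set (rows C) \<subseteq> carrier_vec n" using C rows_carrier[of C] by auto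
  then have "Row C \<subseteq> L \<longleftrightarrow> set (rows C) \<subseteq> L"
    using span_vec_superset[of "set (rows C)" n] span_vec_least[OF _ L] C by (auto simp: Row_def)
  then show ?thesis using C by (auto simp: rows_def)
qed

lemma Rk_full_iff_det:
  fixes A :: "'a::field mat"
  assumes A: "A \<in> carrier_mat m m"
  shows "Rk A = m \<longleftrightarrow> det A \<noteq> 0"
proof -
  interpret vec_space "TYPE('a)" m .
  have "Rk A = rank (A\<^sup>T)" using A by (simp add: Rk_def Row_def dim_vec_def span_vec_def rank_def)
  then show ?thesis using det_rank_iff[of "A\<^sup>T"] A by (simp add: det_transpose)
qed

lemma Rk_transpose_full:
  assumes "A \<in> carrier_mat m m" "Rk A = m"
  shows "Rk (A\<^sup>T) = m"
  using assms Rk_full_iff_det[of A m] Rk_full_iff_det[of "A\<^sup>T" m] by (simp add: det_transpose)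

lemma Rk_full_obtain_inverse:
  assumes A: "A \<in> carrier_mat m m" and rk: "Rk A = m"
  obtains Q where "Q \<in> carrier_mat m m" "A * Q = 1\<^sub>m m"
  using det_non_zero_imp_unit[OF A] rk that unfolding Rk_full_iff_det[OF A]
  by (auto simp: Units_def ring_mat_simps)

lemma image_mult_mat_vec_full_rank:
  fixes A :: "'a::field mat"
  assumes A: "A \<in> carrier_mat m m" "Rk A = m"
  shows "(\<lambda>x. A *\<^sub>v x) ` carrier_vec m = carrier_vec m"
proof (intro equalityI subsetI)
  obtain Q where Q: "Q \<in> carrier_mat m m" "A * Q = 1\<^sub>m m" using Rk_full_obtain_inverse[OF A] .
  fix y :: "'a vec" assume y: "y \<in> carrier_vec m"
  then have "y = A *\<^sub>v (Q *\<^sub>v y)" using assoc_mult_mat_vec[OF A(1) Q(1) y] Q(2) by simp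
  then show "y \<in> (\<lambda>x. A *\<^sub>v x) ` carrier_vec m" using Q(1) y by fastforce
qed (use A(1) in auto)

lemma full_rank_extension:
  assumes L: "subspace_vec k L" and f: "linear_vec_on L r f" and inj: "inj_on f L"
  obtains B where "B \<in> carrier_mat k r" "Rk B = min k r" "\<And>x. x \<in> L \<Longrightarrow> f x = B\<^sup>T *\<^sub>v x"
proof -
  obtain xs where xs: "lin_indpt_list k xs" and L_span: "span_vec k (set xs) = L"
    using ex_basis_list[OF L] .
  have xsL: "set xs \<subseteq> L" using span_vec_superset lin_indpt_list_carrier[OF xs] L_span by blast
  have fxs: "lin_indpt_list r (map f xs)" using lin_indpt_list_map[OF L f inj xs xsL] .
  have p: "length xs \<le> min k r" "length (map f xs) \<le> min k r"
    using length_lin_indpt_list_le[OF xs] length_lin_indpt_list_le[OF fxs] by auto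
  (* Both lists are extended to length min k r only, not to bases: the range of the map matching
     them up is then spanned by an independent list of exactly that length. *)
  obtain ys where ys: "lin_indpt_list k (ys @ xs)" "length (ys @ xs) = min k r"
    using extend_lin_indpt_list_length[OF xs p(1) min.cobounded1] .
  obtain zs where zs: "lin_indpt_list r (zs @ map f xs)" "length (zs @ map f xs) = min k r"
    using extend_lin_indpt_list_length[OF fxs p(2) min.cobounded2] .
  obtain A where A: "A \<in> carrier_mat r k" "map (\<lambda>x. A *\<^sub>v x) (ys @ xs) = zs @ map f xs"
    "(\<lambda>x. A *\<^sub>v x) ` carrier_vec k = span_vec r (set (zs @ map f xs))"
    using ex_mat_mapping_lin_indpt_list[OF ys(1) lin_indpt_list_carrier[OF zs(1)]] ys(2) zs(2)
    by metis
  have "map f xs = map (\<lambda>x. A *\<^sub>v x) xs" using A(2) ys(2) zs(2) by simp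
  then have "f x = A *\<^sub>v x" if "x \<in> L" for x
    using linear_vec_on_span_eqI[of k "set xs" r f "\<lambda>x. A *\<^sub>v x" x] that f
      linear_vec_on_mult_mat_vec[OF A(1) subspace_vec_subset_carrier[OF L]]
      lin_indpt_list_carrier[OF xs]
    unfolding L_span by simp
  moreover have "Rk (A\<^sup>T) = min k r"
    using dim_span_lin_indpt_list[OF zs(1)] zs(2) Row_eq_image[of "A\<^sup>T" k r] A(1,3)
    by (simp add: Rk_def)
  ultimately show ?thesis using that[of "A\<^sup>T"] A(1) by simp
qed

lemma Row_mult:
  assumes A: "A \<in> carrier_mat m m" "Rk A = m" and C: "C \<in> carrier_mat m n"
    and B: "B \<in> carrier_mat n n'"
  shows "Row (A * C * B) = (\<lambda>x. B\<^sup>T *\<^sub>v x) ` Row C"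
proof -
  have AT: "A\<^sup>T \<in> carrier_mat m m" using A by simp
  have mult: "(A * C * B)\<^sup>T *\<^sub>v y = B\<^sup>T *\<^sub>v (C\<^sup>T *\<^sub>v (A\<^sup>T *\<^sub>v y))" if y: "y \<in> carrier_vec m" for y
  proof -
    have CA: "C\<^sup>T * A\<^sup>T \<in> carrier_mat n m" using A C by simp
    have "(A * C * B)\<^sup>T = B\<^sup>T * (C\<^sup>T * A\<^sup>T)"
      using transpose_mult[OF mult_carrier_mat[OF A(1) C] B] transpose_mult[OF A(1) C] by simp
    also have "\<dots> *\<^sub>v y = B\<^sup>T *\<^sub>v ((C\<^sup>T * A\<^sup>T) *\<^sub>v y)"
      using B CA y by (intro assoc_mult_mat_vec) auto
    also have "(C\<^sup>T * A\<^sup>T) *\<^sub>v y = C\<^sup>T *\<^sub>v (A\<^sup>T *\<^sub>v y)"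
      using C AT y by (intro assoc_mult_mat_vec) auto
    finally show ?thesis .
  qed
  have "Row (A * C * B) = (\<lambda>y. (A * C * B)\<^sup>T *\<^sub>v y) ` carrier_vec m"
    using A B C by (intro Row_eq_image) auto
  also have "\<dots> = (\<lambda>y. B\<^sup>T *\<^sub>v (C\<^sup>T *\<^sub>v (A\<^sup>T *\<^sub>v y))) ` carrier_vec m"
    using mult by (rule image_cong[OF refl])
  also have "\<dots> = (\<lambda>x. B\<^sup>T *\<^sub>v x) ` (\<lambda>y. C\<^sup>T *\<^sub>v y) ` (\<lambda>y. A\<^sup>T *\<^sub>v y) ` carrier_vec m"
    by (simp add: image_image)
  also have "(\<lambda>y. A\<^sup>T *\<^sub>v y) ` carrier_vec m = carrier_vec m"
    by (rule image_mult_mat_vec_full_rank[OF AT Rk_transpose_full[OF A]])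
  finally show ?thesis by (simp only: Row_eq_image[OF C])
qed

lemma VL_iff_rows:
  assumes "subspace_vec n L"
  shows "C \<in> VL m n L \<longleftrightarrow> C \<in> carrier_mat m n \<and> (\<forall>i<m. row C i \<in> L)"
  using Row_subset_iff[OF _ assms] by (auto simp: VL_def)

lemma VL_subset_carrier: "VL m n L \<subseteq> carrier_mat m n"
  by (auto simp: VL_def)

lemma VL_mono: "L \<subseteq> L' \<Longrightarrow> VL m n L \<subseteq> VL m n L'"
  by (auto simp: VL_def)

lemma VL_carrier_vec: "VL m n (carrier_vec n) = carrier_mat m n"
  by (auto simp: VL_iff_rows[OF subspace_carrier_vec])

lemma subspace_VL:
  assumes "subspace_vec n L"
  shows "subspace_mat m n (VL m n L)"
  using subspace_vecD[OF assms] by (auto simp: subspace_mat_iff VL_iff_rows[OF assms])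

lemma rank_support_space_VL: "subspace_vec n L \<Longrightarrow> rank_support_space m n (VL m n L)"
  by (auto simp: rank_support_space_def)

lemma Union_Row_carrier:
  assumes "D \<subseteq> carrier_mat m n"
  shows "(\<Union>C\<in>D. Row C) \<subseteq> carrier_vec n"
proof (rule UN_least)
  fix C assume "C \<in> D"
  with assms have "C \<in> carrier_mat m n" by blast
  then show "Row C \<subseteq> carrier_vec n" by (rule subspace_vec_subset_carrier[OF subspace_Row])
qed

lemma subspace_RSupp: "D \<subseteq> carrier_mat m n \<Longrightarrow> subspace_vec n (RSupp n D)"
  unfolding RSupp_def by (rule subspace_span_vec[OF Union_Row_carrier])

lemma RSupp_subset_iff:
  assumes D: "D \<subseteq> carrier_mat m n" and L: "subspace_vec n L"
  shows "RSupp n D \<subseteq> L \<longleftrightarrow> D \<subseteq> VL m n L"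
proof -
  have "RSupp n D \<subseteq> L \<longleftrightarrow> (\<Union>C\<in>D. Row C) \<subseteq> L"
    using span_vec_superset[OF Union_Row_carrier[OF D]] span_vec_least[OF _ L]
    unfolding RSupp_def by blast
  then show ?thesis using D by (auto simp: VL_def)
qed

lemma subset_VL_RSupp: "D \<subseteq> carrier_mat m n \<Longrightarrow> D \<subseteq> VL m n (RSupp n D)"
  using RSupp_subset_iff[OF _ subspace_RSupp] by blast

lemma wtR_le_1_iff:
  assumes D: "D \<subseteq> carrier_mat m n"
  shows "wtR n D \<le> 1 \<longleftrightarrow> (\<exists>v\<in>carrier_vec n. D \<subseteq> VL m n (line v))"
  unfolding wtR_def dim_vec_le_1_iff[OF subspace_RSupp[OF D]]
  using RSupp_subset_iff[OF D subspace_line] by blast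

lemma RSupp_range_smult:
  assumes C: "C \<in> carrier_mat m n"
  shows "RSupp n (range (\<lambda>c. c \<cdot>\<^sub>m C)) = Row C"
proof
  have D: "range (\<lambda>c. c \<cdot>\<^sub>m C) \<subseteq> carrier_mat m n" using C by auto
  have "C \<in> VL m n (Row C)" using C by (simp add: VL_def)
  then show "RSupp n (range (\<lambda>c. c \<cdot>\<^sub>m C)) \<subseteq> Row C"
    using subspace_mat_smult[OF subspace_VL[OF subspace_Row[OF C]]]
    by (auto simp: RSupp_subset_iff[OF D subspace_Row[OF C]])
  have "C = 1 \<cdot>\<^sub>m C" by auto
  then have "C \<in> range (\<lambda>c. c \<cdot>\<^sub>m C)" by blast
  then show "Row C \<subseteq> RSupp n (range (\<lambda>c. c \<cdot>\<^sub>m C))"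
    using subset_VL_RSupp[OF D] by (auto simp: VL_def)
qed

lemma subspace_range_smult:
  assumes C: "C \<in> carrier_mat m n"
  shows "subspace_mat m n (range (\<lambda>c. c \<cdot>\<^sub>m C))"
  unfolding subspace_mat_iff
proof (intro conjI ballI allI)
  show "range (\<lambda>c. c \<cdot>\<^sub>m C) \<subseteq> carrier_mat m n" using C by auto
  have "0\<^sub>m m n = 0 \<cdot>\<^sub>m C" using C by auto
  then show "0\<^sub>m m n \<in> range (\<lambda>c. c \<cdot>\<^sub>m C)" by blast
  show "X + Y \<in> range (\<lambda>c. c \<cdot>\<^sub>m C)" if "X \<in> range (\<lambda>c. c \<cdot>\<^sub>m C)" "Y \<in> range (\<lambda>c. c \<cdot>\<^sub>m C)" for X Y
    using that by (auto simp flip: add_smult_distrib_right_mat[OF C])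
  show "a \<cdot>\<^sub>m X \<in> range (\<lambda>c. c \<cdot>\<^sub>m C)" if "X \<in> range (\<lambda>c. c \<cdot>\<^sub>m C)" for a X
  proof -
    have "a \<cdot>\<^sub>m (c \<cdot>\<^sub>m C) = (a * c) \<cdot>\<^sub>m C" for c by (intro eq_matI) auto
    then show ?thesis using that by auto
  qed
qed

lemma wtR_range_smult: "C \<in> carrier_mat m n \<Longrightarrow> wtR n (range (\<lambda>c. c \<cdot>\<^sub>m C)) = Rk C"
  by (auto simp: wtR_def Rk_def RSupp_range_smult)

lemma RSupp_image_mult:
  assumes A: "A \<in> carrier_mat m m" "Rk A = m" and B: "B \<in> carrier_mat n n'"
    and D: "D \<subseteq> carrier_mat m n"
  shows "RSupp n' ((\<lambda>C. A * C * B) ` D) = (\<lambda>x. B\<^sup>T *\<^sub>v x) ` RSupp n D"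
proof -
  have BT: "B\<^sup>T \<in> carrier_mat n' n" using B by simp
  have "(\<Union>C\<in>(\<lambda>C. A * C * B) ` D. Row C) = (\<lambda>x. B\<^sup>T *\<^sub>v x) ` (\<Union>C\<in>D. Row C)"
    using Row_mult[OF A _ B] D by (auto simp: image_UN subset_iff)
  then show ?thesis
    using span_vec_image[OF subspace_carrier_vec linear_vec_on_mult_mat_vec[OF BT order_refl]
        Union_Row_carrier[OF D]]
    by (simp add: RSupp_def)
qed

section \<open>Matrices of rank at most one\<close>

definition outer :: "'a::field vec \<Rightarrow> 'a vec \<Rightarrow> 'a mat" where
  "outer u v = mat (Matrix.dim_vec u) (Matrix.dim_vec v) (\<lambda>(i,j). u $ i * v $ j)"

lemma outer_carrier [simp]:
  "u \<in> carrier_vec m \<Longrightarrow> v \<in> carrier_vec n \<Longrightarrow> outer u v \<in> carrier_mat m n"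
  by (auto simp: outer_def)

lemma index_outer [simp]:
  "i < Matrix.dim_vec u \<Longrightarrow> j < Matrix.dim_vec v \<Longrightarrow> outer u v $$ (i,j) = u $ i * v $ j"
  by (simp add: outer_def)

lemma dim_outer [simp]:
  "dim_row (outer u v) = Matrix.dim_vec u" "dim_col (outer u v) = Matrix.dim_vec v"
  by (simp_all add: outer_def)

lemma row_outer [simp]: "i < Matrix.dim_vec u \<Longrightarrow> row (outer u v) i = u $ i \<cdot>\<^sub>v v"
  by (intro eq_vecI) auto

lemma transpose_outer: "(outer u v)\<^sup>T = outer v u"
  by (intro eq_matI) auto

lemma outer_add_left:
  "u \<in> carrier_vec m \<Longrightarrow> u' \<in> carrier_vec m \<Longrightarrow> outer (u + u') v = outer u v + outer u' v"
  by (intro eq_matI) (auto simp: distrib_right)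

lemma outer_add_right:
  "v \<in> carrier_vec n \<Longrightarrow> v' \<in> carrier_vec n \<Longrightarrow> outer u (v + v') = outer u v + outer u v'"
  by (intro eq_matI) (auto simp: distrib_left)

lemma outer_smult_left: "outer (c \<cdot>\<^sub>v u) v = c \<cdot>\<^sub>m outer u v"
  by (intro eq_matI) auto

lemma outer_smult_right: "outer u (c \<cdot>\<^sub>v v) = c \<cdot>\<^sub>m outer u v"
  by (intro eq_matI) auto

lemma outer_zero_left [simp]: "v \<in> carrier_vec n \<Longrightarrow> outer (0\<^sub>v m) v = 0\<^sub>m m n"
  by (intro eq_matI) auto

lemma outer_zero_right [simp]: "u \<in> carrier_vec m \<Longrightarrow> outer u (0\<^sub>v n) = 0\<^sub>m m n"
  by (intro eq_matI) auto

lemma mult_outer: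
  assumes A: "A \<in> carrier_mat k m" and u: "u \<in> carrier_vec m"
    and B: "B \<in> carrier_mat n l" and v: "v \<in> carrier_vec n"
  shows "A * outer u v * B = outer (A *\<^sub>v u) (B\<^sup>T *\<^sub>v v)"
proof -
  have "A * outer u v = outer (A *\<^sub>v u) v"
    using A u by (intro eq_matI) (auto simp: scalar_prod_def sum_distrib_right mult.assoc)
  moreover have "outer u' v * B = outer u' (B\<^sup>T *\<^sub>v v)" for u'
    using B v by (intro eq_matI) (auto simp: scalar_prod_def sum_distrib_left ac_simps)
  ultimately show ?thesis by simp
qed

lemma nonzero_vec_obtain_index:
  assumes "v \<in> carrier_vec n" "v \<noteq> 0\<^sub>v n"
  obtains i where "i < n" "v $ i \<noteq> 0"
  using assms eq_vecI[of v "0\<^sub>v n"] by auto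

lemma outer_right_cancel:
  assumes eq: "outer a w = outer b w"
    and ab: "a \<in> carrier_vec m" "b \<in> carrier_vec m" and w: "w \<in> carrier_vec n" "w \<noteq> 0\<^sub>v n"
  shows "a = b"
proof -
  obtain t where t: "t < n" "w $ t \<noteq> 0" using nonzero_vec_obtain_index[OF w] .
  have "a $ i * w $ t = b $ i * w $ t" if "i < m" for i
    using arg_cong[OF eq, of "\<lambda>C. C $$ (i,t)"] that t ab w by simp
  then show ?thesis using t ab by (intro eq_vecI) auto
qed

lemma outer_left_cancel:
  assumes eq: "outer w a = outer w b"
    and ab: "a \<in> carrier_vec n" "b \<in> carrier_vec n" and w: "w \<in> carrier_vec m" "w \<noteq> 0\<^sub>v m"
  shows "a = b"
  using outer_right_cancel[OF _ ab w] arg_cong[OF eq, of transpose_mat]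
  by (simp add: transpose_outer)

lemma outer_eq_zero_iff:
  assumes u: "u \<in> carrier_vec m" and v: "v \<in> carrier_vec n"
  shows "outer u v = 0\<^sub>m m n \<longleftrightarrow> u = 0\<^sub>v m \<or> v = 0\<^sub>v n"
  using outer_left_cancel[OF _ v zero_carrier_vec u] u v by auto

lemma outer_in_VL:
  assumes L: "subspace_vec n L" and "u \<in> carrier_vec m" "v \<in> L"
  shows "outer u v \<in> VL m n L"
  using assms subspace_vecD[OF L] by (auto simp: VL_iff_rows[OF L])

lemma in_VL_line_iff:
  assumes w: "w \<in> carrier_vec n"
  shows "C \<in> VL m n (line w) \<longleftrightarrow> (\<exists>u\<in>carrier_vec m. C = outer u w)"
proof
  assume "C \<in> VL m n (line w)"
  then have C: "C \<in> carrier_mat m n" and "\<forall>i<m. \<exists>c. row C i = c \<cdot>\<^sub>v w"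
    by (auto simp: VL_iff_rows[OF subspace_line[OF w]] in_line_iff)
  then obtain c where "\<And>i. i < m \<Longrightarrow> row C i = c i \<cdot>\<^sub>v w" by metis
  then have "C = outer (vec m c) w" using C w by (intro eq_rowI) auto
  then show "\<exists>u\<in>carrier_vec m. C = outer u w" by (rule bexI) simp
qed (use w in \<open>auto simp: VL_iff_rows[OF subspace_line[OF w]]\<close>)

lemma VL_line: "w \<in> carrier_vec n \<Longrightarrow> VL m n (line w) = (\<lambda>u. outer u w) ` carrier_vec m"
  by (auto simp: in_VL_line_iff)

lemma VL_zero: "VL m n {0\<^sub>v n} = {0\<^sub>m m n}"
proof (intro equalityI subsetI)
  fix C :: "'a mat" assume "C \<in> VL m n {0\<^sub>v n}"
  then show "C \<in> {0\<^sub>m m n}"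
    using in_VL_line_iff[OF zero_carrier_vec, of C m n] by (auto simp: line_zero)
qed (simp add: subspace_mat_zero[OF subspace_VL[OF subspace_zero_vec]])

lemma Rk_le_1_iff:
  assumes C: "C \<in> carrier_mat m n"
  shows "Rk C \<le> 1 \<longleftrightarrow> (\<exists>u\<in>carrier_vec m. \<exists>v\<in>carrier_vec n. C = outer u v)"
proof -
  have "Rk C \<le> 1 \<longleftrightarrow> (\<exists>v\<in>carrier_vec n. C \<in> VL m n (line v))"
    using C dim_vec_le_1_iff[OF subspace_Row[OF C]] by (simp add: Rk_def VL_def)
  then show ?thesis using in_VL_line_iff by blast
qed

lemma Rk_transpose_le_1:
  assumes C: "C \<in> carrier_mat m n" and "Rk C \<le> 1"
  shows "Rk (C\<^sup>T) \<le> 1"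
proof -
  obtain u v where uv: "u \<in> carrier_vec m" "v \<in> carrier_vec n" and "C = outer u v"
    using assms Rk_le_1_iff by blast
  then have "C\<^sup>T = outer v u" by (simp add: transpose_outer)
  moreover have "C\<^sup>T \<in> carrier_mat n m" using C by simp
  ultimately show ?thesis using uv by (metis Rk_le_1_iff)
qed

lemma in_line_if_minors_vanish:
  assumes a: "a \<in> carrier_vec m" "a \<noteq> 0\<^sub>v m" and c: "c \<in> carrier_vec m"
    and minors: "\<And>i j. i < m \<Longrightarrow> j < m \<Longrightarrow> a $ i * c $ j = a $ j * c $ i"
  shows "c \<in> line a"
proof -
  obtain i where i: "i < m" "a $ i \<noteq> 0" using nonzero_vec_obtain_index[OF a] .
  have "c = (c $ i / a $ i) \<cdot>\<^sub>v a"
    using a c i minors[OF i(1)] by (intro eq_vecI) (auto simp: field_simps)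
  then show ?thesis by (metis smult_in_line)
qed

lemma outer_add_outer_eq_outer:
  assumes b: "b \<in> carrier_vec n" "b \<noteq> 0\<^sub>v n" and d: "d \<in> carrier_vec n" "d \<notin> line b"
    and y: "y \<in> carrier_vec n"
  shows "\<exists>\<alpha> \<beta>. \<forall>a\<in>carrier_vec m. \<forall>c\<in>carrier_vec m. \<forall>x\<in>carrier_vec m.
    outer a b + outer c d = outer x y \<longrightarrow> a = \<alpha> \<cdot>\<^sub>v x \<and> c = \<beta> \<cdot>\<^sub>v x"
proof -
  obtain i j where ij: "i < n" "j < n" and minor: "b $ i * d $ j - b $ j * d $ i \<noteq> 0"
    using in_line_if_minors_vanish[OF b d(1)] d(2) by auto
  define \<delta> where "\<delta> = b $ i * d $ j - b $ j * d $ i"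
  have "\<delta> \<noteq> 0" using minor by (simp add: \<delta>_def)
  show ?thesis
  proof (intro exI ballI impI)
    fix a c x :: "'a vec"
    assume acx: "a \<in> carrier_vec m" "c \<in> carrier_vec m" "x \<in> carrier_vec m"
      and eq: "outer a b + outer c d = outer x y"
    have entry: "a $ k * b $ l + c $ k * d $ l = x $ k * y $ l" if "k < m" "l < n" for k l
      using arg_cong[OF eq, of "\<lambda>C. C $$ (k,l)"] that acx b(1) d(1) y by simp
    have "a $ k = (y $ i * d $ j - y $ j * d $ i) / \<delta> * x $ k" if k: "k < m" for k
    proof -
      have "a $ k * \<delta>
          = (a $ k * b $ i + c $ k * d $ i) * d $ j - (a $ k * b $ j + c $ k * d $ j) * d $ i"
        by (simp add: \<delta>_def algebra_simps)
      also have "\<dots> = x $ k * (y $ i * d $ j - y $ j * d $ i)"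
        unfolding entry[OF k ij(1)] entry[OF k ij(2)] by (simp add: algebra_simps)
      finally show ?thesis using \<open>\<delta> \<noteq> 0\<close> by (simp add: field_simps)
    qed
    moreover have "c $ k = (b $ i * y $ j - b $ j * y $ i) / \<delta> * x $ k" if k: "k < m" for k
    proof -
      have "c $ k * \<delta>
          = b $ i * (a $ k * b $ j + c $ k * d $ j) - b $ j * (a $ k * b $ i + c $ k * d $ i)"
        by (simp add: \<delta>_def algebra_simps)
      also have "\<dots> = x $ k * (b $ i * y $ j - b $ j * y $ i)"
        unfolding entry[OF k ij(1)] entry[OF k ij(2)] by (simp add: algebra_simps)
      finally show ?thesis using \<open>\<delta> \<noteq> 0\<close> by (simp add: field_simps)
    qed
    ultimately show "a = ((y $ i * d $ j - y $ j * d $ i) / \<delta>) \<cdot>\<^sub>v x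
        \<and> c = ((b $ i * y $ j - b $ j * y $ i) / \<delta>) \<cdot>\<^sub>v x"
      using acx by (intro conjI eq_vecI) auto
  qed
qed

lemma in_line_if_Rk_add_le_1:
  assumes a: "a \<in> carrier_vec m" "a \<noteq> 0\<^sub>v m" and b: "b \<in> carrier_vec n" "b \<noteq> 0\<^sub>v n"
    and c: "c \<in> carrier_vec m" and d: "d \<in> carrier_vec n" "d \<notin> line b"
    and rank: "Rk (outer a b + outer c d) \<le> 1"
  shows "c \<in> line a"
proof -
  have "outer a b + outer c d \<in> carrier_mat m n" using a b c d by simp
  then obtain x y where xy: "x \<in> carrier_vec m" "y \<in> carrier_vec n"
    and eq: "outer a b + outer c d = outer x y" using rank Rk_le_1_iff by blast
  obtain \<alpha> \<beta> where \<alpha>: "a = \<alpha> \<cdot>\<^sub>v x" and \<beta>: "c = \<beta> \<cdot>\<^sub>v x"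
    using outer_add_outer_eq_outer[OF b d xy(2)] a(1) c xy(1) eq by blast
  have "\<alpha> \<noteq> 0" using \<alpha> a(2) xy(1) by auto
  then have "line a = line x" unfolding \<alpha> by (rule line_smult)
  then show ?thesis by (simp add: \<beta>)
qed

lemma in_line_if_outer_in_rank_le_1_subspace:
  assumes D: "subspace_mat m n D" and rank: "\<And>C. C \<in> D \<Longrightarrow> Rk C \<le> 1"
    and a: "a \<in> carrier_vec m" "a \<noteq> 0\<^sub>v m" and b: "b \<in> carrier_vec n" "b \<noteq> 0\<^sub>v n"
    and c: "c \<in> carrier_vec m" "c \<noteq> 0\<^sub>v m" and d: "d \<in> carrier_vec n" "d \<notin> line b"
    and x: "x \<in> carrier_vec m" and y: "y \<in> carrier_vec n" "y \<noteq> 0\<^sub>v n"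
    and mem: "outer a b \<in> D" "outer c d \<in> D" "outer x y \<in> D"
  shows "x \<in> line a"
proof (cases "y \<in> line b")
  case False
  then show ?thesis
    by (rule in_line_if_Rk_add_le_1[OF a b x y(1) _ rank[OF subspace_mat_add[OF D mem(1,3)]]])
next
  case True
  have d_nz: "d \<noteq> 0\<^sub>v n" using d(2) subspace_vec_zero[OF subspace_line[OF b(1)]] by blast
  have "y \<notin> line d"
    using line_eq[OF b(1) True y(2)] line_eq[OF d(1) _ y(2)] d(2) by (metis self_in_line)
  then have "x \<in> line c"
    by (rule in_line_if_Rk_add_le_1[OF c d(1) d_nz x y(1) _
          rank[OF subspace_mat_add[OF D mem(2,3)]]])
  moreover have "c \<in> line a"
    by (rule in_line_if_Rk_add_le_1[OF a b c(1) d rank[OF subspace_mat_add[OF D mem(1,2)]]])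
  ultimately show ?thesis using line_subset[OF subspace_line[OF a(1)]] by blast
qed

lemma rank_le_1_subspace_cases:
  assumes D: "subspace_mat m n D" and rank: "\<And>C. C \<in> D \<Longrightarrow> Rk C \<le> 1"
  obtains (row) w where "w \<in> carrier_vec n" "D \<subseteq> VL m n (line w)"
  | (column) w where "w \<in> carrier_vec m" "transpose_mat ` D \<subseteq> VL n m (line w)"
proof (cases "\<exists>w\<in>carrier_vec n. D \<subseteq> VL m n (line w)")
  case True
  then show ?thesis using row by blast
next
  case False
  have outer_ex: "\<exists>u\<in>carrier_vec m. \<exists>v\<in>carrier_vec n. C = outer u v" if "C \<in> D" for C
    using rank[OF that] Rk_le_1_iff subspace_mat_subset_carrier[OF D] that by blast
  obtain a b where ab: "a \<in> carrier_vec m" "b \<in> carrier_vec n" "outer a b \<in> D"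
    and "outer a b \<notin> VL m n (line (0\<^sub>v n))"
    using False zero_carrier_vec outer_ex by blast
  then have nz: "a \<noteq> 0\<^sub>v m" "b \<noteq> 0\<^sub>v n" by (auto simp: in_VL_line_iff)
  have lb: "subspace_vec n (line b)" and la: "subspace_vec m (line a)"
    using ab by (auto intro: subspace_line)
  obtain c d where cd: "c \<in> carrier_vec m" "d \<in> carrier_vec n" "outer c d \<in> D"
    and notin: "outer c d \<notin> VL m n (line b)" using False ab(2) outer_ex by blast
  have c_nz: "c \<noteq> 0\<^sub>v m" using notin cd(2) subspace_mat_zero[OF subspace_VL[OF lb]] by auto
  have d_notin: "d \<notin> line b" using notin outer_in_VL[OF lb cd(1)] by blast
  have "outer y x \<in> VL n m (line a)"
    if xy: "x \<in> carrier_vec m" "y \<in> carrier_vec n" "outer x y \<in> D" for x y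
  proof (cases "y = 0\<^sub>v n")
    case True
    then show ?thesis using subspace_mat_zero[OF subspace_VL[OF la]] xy(1) by simp
  next
    case False
    have "x \<in> line a"
      using in_line_if_outer_in_rank_le_1_subspace[OF D rank ab(1) nz(1) ab(2) nz(2) cd(1) c_nz
          cd(2) d_notin xy(1,2) False ab(3) cd(3) xy(3)] .
    then show ?thesis by (rule outer_in_VL[OF la xy(2)])
  qed
  then have "transpose_mat ` D \<subseteq> VL n m (line a)"
    using outer_ex by (fastforce simp: transpose_outer)
  then show ?thesis by (rule column[OF ab(1)])
qed

lemma in_subspace_if_outer_in_VL:
  assumes L: "subspace_vec n L" and u: "u \<in> carrier_vec m" "u \<noteq> 0\<^sub>v m"
    and uv: "outer u v \<in> VL m n L"
  shows "v \<in> L"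
proof -
  obtain i where i: "i < m" "u $ i \<noteq> 0" using nonzero_vec_obtain_index[OF u] .
  have "row (outer u v) i \<in> L" using uv i(1) by (simp add: VL_iff_rows[OF L] del: row_outer)
  then have "u $ i \<cdot>\<^sub>v v \<in> L" using i(1) u(1) by simp
  then have "inverse (u $ i) \<cdot>\<^sub>v (u $ i \<cdot>\<^sub>v v) \<in> L" by (rule subspace_vec_smult[OF L])
  then show ?thesis using i(2) by (simp add: smult_smult_assoc)
qed

lemma VL_subset_iff:
  assumes S: "subspace_vec n S" and T: "subspace_vec n T"
  shows "VL m n S \<subseteq> VL m n T \<longleftrightarrow> m = 0 \<or> S \<subseteq> T"
proof (cases "m = 0")
  case True
  then show ?thesis by (auto simp: VL_iff_rows[OF S] VL_iff_rows[OF T])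
next
  case False
  let ?e = "unit_vec m 0 :: 'a vec"
  have e: "?e \<in> carrier_vec m" "?e \<noteq> 0\<^sub>v m" using False by auto
  have "S \<subseteq> T" if "VL m n S \<subseteq> VL m n T"
    using that outer_in_VL[OF S e(1)] in_subspace_if_outer_in_VL[OF T e] by blast
  then show ?thesis using False VL_mono by blast
qed

lemma rank_support_space_subset_VL_line:
  assumes U: "rank_support_space m n U" "U \<subseteq> VL m n (line v)" and v: "v \<in> carrier_vec n"
  shows "U = {0\<^sub>m m n} \<or> U = VL m n (line v)"
proof -
  obtain S where S: "subspace_vec n S" and US: "U = VL m n S"
    using U(1) by (auto simp: rank_support_space_def)
  have lv: "subspace_vec n (line v)" by (rule subspace_line[OF v])
  consider (no_rows) "m = 0" | (sub_line) "S \<subseteq> line v"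
    using U(2) unfolding US VL_subset_iff[OF S lv] by blast
  then show ?thesis
  proof cases
    case no_rows
    then have "VL m n (line v) \<subseteq> U" unfolding US VL_subset_iff[OF lv S] by simp
    then show ?thesis using U(2) by blast
  next
    case sub_line
    then show ?thesis using subspace_subset_line[OF S _ v] US VL_zero by auto
  qed
qed

lemma VL_subset_if_outer:
  assumes L: "subspace_vec n L" and D: "subspace_mat m n D"
    and outer: "\<And>u v. u \<in> carrier_vec m \<Longrightarrow> v \<in> L \<Longrightarrow> outer u v \<in> D"
  shows "VL m n L \<subseteq> D"
proof
  fix C assume "C \<in> VL m n L"
  then have C: "C \<in> carrier_mat m n" and rows: "\<And>i. i < m \<Longrightarrow> row C i \<in> L"
    by (auto simp: VL_iff_rows[OF L])
  define T where "T = (\<lambda>t. mat m n (\<lambda>(i,j). if i < t then C $$ (i,j) else 0))"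
  have "T t \<in> D" if "t \<le> m" for t
    using that
  proof (induction t)
    case 0
    have "T 0 = 0\<^sub>m m n" by (auto simp: T_def)
    then show ?case using subspace_mat_zero[OF D] by simp
  next
    case (Suc t)
    have "T (Suc t) = T t + outer (unit_vec m t) (row C t)"
      using C Suc.prems by (intro eq_matI) (auto simp: T_def less_Suc_eq)
    then show ?case using Suc rows by (simp add: subspace_mat_add[OF D] outer)
  qed
  moreover have "T m = C" using C by (auto simp: T_def)
  ultimately show "C \<in> D" by (metis order_refl)
qed

lemma linear_vec_on_if_outer_left:
  assumes S: "subspace_vec k S" and g: "\<And>x. x \<in> S \<Longrightarrow> g x \<in> carrier_vec r"
    and w: "w \<in> carrier_vec m" "w \<noteq> 0\<^sub>v m"
    and add: "\<And>x y. x \<in> S \<Longrightarrow> y \<in> S \<Longrightarrow> outer w (g (x + y)) = outer w (g x) + outer w (g y)"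
    and smult: "\<And>c x. x \<in> S \<Longrightarrow> outer w (g (c \<cdot>\<^sub>v x)) = c \<cdot>\<^sub>m outer w (g x)"
  shows "linear_vec_on S r g"
proof (rule linear_vec_onI)
  show "g (x + y) = g x + g y" if "x \<in> S" "y \<in> S" for x y
    using that g add[OF that] subspace_vec_add[OF S that]
    by (intro outer_left_cancel[OF _ _ _ w, of _ _ r]) (simp_all add: outer_add_right[of _ r])
  show "g (c \<cdot>\<^sub>v x) = c \<cdot>\<^sub>v g x" if "x \<in> S" for c x
    using that g smult[OF that] subspace_vec_smult[OF S that]
    by (intro outer_left_cancel[OF _ _ _ w, of _ _ r]) (simp_all add: outer_smult_right)
qed (rule g)

lemma linear_vec_on_if_outer_right:
  assumes S: "subspace_vec k S" and g: "\<And>x. x \<in> S \<Longrightarrow> g x \<in> carrier_vec r"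
    and w: "w \<in> carrier_vec n" "w \<noteq> 0\<^sub>v n"
    and add: "\<And>x y. x \<in> S \<Longrightarrow> y \<in> S \<Longrightarrow> outer (g (x + y)) w = outer (g x) w + outer (g y) w"
    and smult: "\<And>c x. x \<in> S \<Longrightarrow> outer (g (c \<cdot>\<^sub>v x)) w = c \<cdot>\<^sub>m outer (g x) w"
  shows "linear_vec_on S r g"
proof (rule linear_vec_onI)
  show "g (x + y) = g x + g y" if "x \<in> S" "y \<in> S" for x y
    using that g add[OF that] subspace_vec_add[OF S that]
    by (intro outer_right_cancel[OF _ _ _ w, of _ _ r]) (simp_all add: outer_add_left[of _ r])
  show "g (c \<cdot>\<^sub>v x) = c \<cdot>\<^sub>v g x" if "x \<in> S" for c x
    using that g smult[OF that] subspace_vec_smult[OF S that]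
    by (intro outer_right_cancel[OF _ _ _ w, of _ _ r]) (simp_all add: outer_smult_left)
qed (rule g)

section \<open>Linear embeddings of rank support spaces\<close>

definition matrix_equivalence_on ::
    "nat \<Rightarrow> nat \<Rightarrow> nat \<Rightarrow> 'a::field mat set \<Rightarrow> ('a mat \<Rightarrow> 'a mat) \<Rightarrow> bool" where
  "matrix_equivalence_on m n n' V \<phi> \<longleftrightarrow> (\<exists>A\<in>carrier_mat m m. \<exists>B\<in>carrier_mat n n'.
     Rk A = m \<and> Rk B = min n n' \<and> (\<forall>C\<in>V. \<phi> C = A * C * B))"

definition preserves_rank_supports ::
    "nat \<Rightarrow> nat \<Rightarrow> nat \<Rightarrow> 'a::field mat set \<Rightarrow> ('a mat \<Rightarrow> 'a mat) \<Rightarrow> bool" where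
  "preserves_rank_supports m n n' V \<phi> \<longleftrightarrow> (\<forall>U. subspace_mat m n U \<and> U \<subseteq> V \<longrightarrow>
     (rank_support_space m n U \<longleftrightarrow> rank_support_space m n' (\<phi> ` U)))"

lemma preserves_rank_supportsD:
  "preserves_rank_supports m n n' V \<phi> \<Longrightarrow> subspace_mat m n U \<Longrightarrow> U \<subseteq> V \<Longrightarrow>
    rank_support_space m n U \<longleftrightarrow> rank_support_space m n' (\<phi> ` U)"
  by (simp add: preserves_rank_supports_def)

definition preserves_weights ::
    "nat \<Rightarrow> nat \<Rightarrow> nat \<Rightarrow> 'a::field mat set \<Rightarrow> ('a mat \<Rightarrow> 'a mat) \<Rightarrow> bool" where
  "preserves_weights m n n' V \<phi> \<longleftrightarrow>
     (\<forall>D. subspace_mat m n D \<and> D \<subseteq> V \<longrightarrow> wtR n' (\<phi> ` D) = wtR n D)"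

lemma preserves_weightsD:
  "preserves_weights m n n' V \<phi> \<Longrightarrow> subspace_mat m n D \<Longrightarrow> D \<subseteq> V \<Longrightarrow> wtR n' (\<phi> ` D) = wtR n D"
  by (simp add: preserves_weights_def)

definition preserves_rank :: "'a::field mat set \<Rightarrow> ('a mat \<Rightarrow> 'a mat) \<Rightarrow> bool" where
  "preserves_rank V \<phi> \<longleftrightarrow> (\<forall>C\<in>V. Rk (\<phi> C) = Rk C)"

locale rank_support_embedding =
  fixes m n n' :: nat and L :: "'a::field vec set" and \<phi> :: "'a mat \<Rightarrow> 'a mat"
  assumes L: "subspace_vec n L"
    and maps_carrier: "\<And>C. C \<in> VL m n L \<Longrightarrow> \<phi> C \<in> carrier_mat m n'"
    and add: "\<And>C D. C \<in> VL m n L \<Longrightarrow> D \<in> VL m n L \<Longrightarrow> \<phi> (C + D) = \<phi> C + \<phi> D"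
    and smult: "\<And>c C. C \<in> VL m n L \<Longrightarrow> \<phi> (c \<cdot>\<^sub>m C) = c \<cdot>\<^sub>m \<phi> C"
    and inj: "inj_on \<phi> (VL m n L)"
begin

lemma L_carrier: "v \<in> L \<Longrightarrow> v \<in> carrier_vec n"
  by (rule subspace_vec_carrierD[OF L])

lemma zero_in: "0\<^sub>m m n \<in> VL m n L"
  by (rule subspace_mat_zero[OF subspace_VL[OF L]])

lemma zero: "\<phi> (0\<^sub>m m n) = 0\<^sub>m m n'"
proof -
  have "\<phi> (0 \<cdot>\<^sub>m 0\<^sub>m m n) = 0 \<cdot>\<^sub>m \<phi> (0\<^sub>m m n)" by (rule smult[OF zero_in])
  also have "\<dots> = 0\<^sub>m m n'" using maps_carrier[OF zero_in] by auto
  finally show ?thesis by simp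
qed

lemma subspace_mat_image:
  assumes U: "subspace_mat m n U" and UV: "U \<subseteq> VL m n L"
  shows "subspace_mat m n' (\<phi> ` U)"
  unfolding subspace_mat_iff
proof (intro conjI ballI allI)
  show "\<phi> ` U \<subseteq> carrier_mat m n'" using UV maps_carrier by blast
  show "0\<^sub>m m n' \<in> \<phi> ` U" using zero subspace_mat_zero[OF U] by (metis imageI)
  show "C + D \<in> \<phi> ` U" if CD: "C \<in> \<phi> ` U" "D \<in> \<phi> ` U" for C D
  proof -
    obtain C' D' where C': "C' \<in> U" "C = \<phi> C'" and D': "D' \<in> U" "D = \<phi> D'" using CD by blast
    then have "C + D = \<phi> (C' + D')" using add UV by (metis subsetD)
    then show ?thesis using subspace_mat_add[OF U C'(1) D'(1)] by simp
  qed
  show "c \<cdot>\<^sub>m C \<in> \<phi> ` U" if C: "C \<in> \<phi> ` U" for c C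
  proof -
    obtain C' where C': "C' \<in> U" "C = \<phi> C'" using C by blast
    then have "c \<cdot>\<^sub>m C = \<phi> (c \<cdot>\<^sub>m C')" using smult UV by (metis subsetD)
    then show ?thesis using subspace_mat_smult[OF U C'(1)] by simp
  qed
qed

lemma subspace_mat_vimage:
  assumes "subspace_mat m n' D"
  shows "subspace_mat m n {C \<in> VL m n L. \<phi> C \<in> D}"
  using subspace_matD[OF assms] subspace_matD[OF subspace_VL[OF L, of m]] zero
  by (auto simp: subspace_mat_iff add smult)

lemma outer_in: "u \<in> carrier_vec m \<Longrightarrow> v \<in> L \<Longrightarrow> outer u v \<in> VL m n L"
  by (rule outer_in_VL[OF L])

lemma map_outer_add_left:
  "u \<in> carrier_vec m \<Longrightarrow> u' \<in> carrier_vec m \<Longrightarrow> v \<in> L \<Longrightarrow>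
    \<phi> (outer (u + u') v) = \<phi> (outer u v) + \<phi> (outer u' v)"
  by (simp add: outer_add_left add outer_in)

lemma map_outer_add_right:
  "u \<in> carrier_vec m \<Longrightarrow> v \<in> L \<Longrightarrow> v' \<in> L \<Longrightarrow>
    \<phi> (outer u (v + v')) = \<phi> (outer u v) + \<phi> (outer u v')"
  by (simp add: outer_add_right[OF L_carrier L_carrier] add outer_in)

lemma map_outer_smult_left:
  "u \<in> carrier_vec m \<Longrightarrow> v \<in> L \<Longrightarrow> \<phi> (outer (c \<cdot>\<^sub>v u) v) = c \<cdot>\<^sub>m \<phi> (outer u v)"
  by (simp add: outer_smult_left smult outer_in)

lemma map_outer_smult_right:
  "u \<in> carrier_vec m \<Longrightarrow> v \<in> L \<Longrightarrow> \<phi> (outer u (c \<cdot>\<^sub>v v)) = c \<cdot>\<^sub>m \<phi> (outer u v)"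
  by (simp add: outer_smult_right smult outer_in)

lemma map_outer_eq_iff:
  assumes "u \<in> carrier_vec m" "v \<in> L" "u' \<in> carrier_vec m" "v' \<in> L"
  shows "\<phi> (outer u v) = \<phi> (outer u' v') \<longleftrightarrow> outer u v = outer u' v'"
  using inj_on_eq_iff[OF inj outer_in outer_in] assms by blast

lemma map_outer_eq_zero_iff:
  assumes "u \<in> carrier_vec m" "v \<in> L"
  shows "\<phi> (outer u v) = 0\<^sub>m m n' \<longleftrightarrow> u = 0\<^sub>v m \<or> v = 0\<^sub>v n"
  using inj_on_eq_iff[OF inj outer_in zero_in] zero outer_eq_zero_iff assms L_carrier by metis

definition preserves_lines :: bool where
  "preserves_lines \<longleftrightarrow>
     (\<forall>v\<in>L. \<exists>w\<in>carrier_vec n'. \<phi> ` VL m n (line v) \<subseteq> VL m n' (line w))"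

lemma preserves_lines_obtain:
  assumes preserves_lines and v: "v \<in> L"
  obtains g w where "w \<in> carrier_vec n'" "\<And>u. u \<in> carrier_vec m \<Longrightarrow> g u \<in> carrier_vec m"
    "\<And>u. u \<in> carrier_vec m \<Longrightarrow> \<phi> (outer u v) = outer (g u) w"
proof -
  obtain w where w: "w \<in> carrier_vec n'" and sub: "\<phi> ` VL m n (line v) \<subseteq> VL m n' (line w)"
    using assms by (auto simp: preserves_lines_def)
  have "\<exists>u'\<in>carrier_vec m. \<phi> (outer u v) = outer u' w" if u: "u \<in> carrier_vec m" for u
    using outer_in_VL[OF subspace_line[OF L_carrier[OF v]] u self_in_line] sub
    by (auto simp flip: in_VL_line_iff[OF w])
  then show ?thesis using that[OF w] by metis
qed

lemma linear_vec_on_left_factor: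
  assumes v: "v \<in> L" and g: "\<And>u. u \<in> carrier_vec m \<Longrightarrow> g u \<in> carrier_vec m"
    and w: "w \<in> carrier_vec n'" "w \<noteq> 0\<^sub>v n'"
    and eq: "\<And>u. u \<in> carrier_vec m \<Longrightarrow> \<phi> (outer u v) = outer (g u) w"
  shows "linear_vec_on (carrier_vec m) m g"
  using map_outer_add_left[OF _ _ v] map_outer_smult_left[OF _ v]
  by (intro linear_vec_on_if_outer_right[OF subspace_carrier_vec g w]) (simp_all flip: eq)

lemma linear_vec_on_right_factor:
  assumes v: "v \<in> L" and g: "\<And>u. u \<in> carrier_vec m \<Longrightarrow> g u \<in> carrier_vec n'"
    and w: "w \<in> carrier_vec m" "w \<noteq> 0\<^sub>v m"
    and eq: "\<And>u. u \<in> carrier_vec m \<Longrightarrow> \<phi> (outer u v) = outer w (g u)"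
  shows "linear_vec_on (carrier_vec m) n' g"
  using map_outer_add_left[OF _ _ v] map_outer_smult_left[OF _ v]
  by (intro linear_vec_on_if_outer_left[OF subspace_carrier_vec g w]) (simp_all flip: eq)

lemma inj_on_left_argument:
  assumes v: "v \<in> L" "v \<noteq> 0\<^sub>v n" and eq: "\<And>u. u \<in> carrier_vec m \<Longrightarrow> \<phi> (outer u v) = h (g u)"
  shows "inj_on g (carrier_vec m)"
proof (rule inj_onI)
  fix x y assume xy: "x \<in> carrier_vec m" "y \<in> carrier_vec m" "g x = g y"
  then have "\<phi> (outer x v) = \<phi> (outer y v)" using eq by simp
  then have "outer x v = outer y v" using map_outer_eq_iff[OF xy(1) v(1) xy(2) v(1)] by simp
  then show "x = y" by (rule outer_right_cancel[OF _ xy(1,2) L_carrier[OF v(1)] v(2)])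
qed

lemma inj_on_right_argument:
  assumes u: "u \<in> carrier_vec m" "u \<noteq> 0\<^sub>v m" and eq: "\<And>v. v \<in> L \<Longrightarrow> \<phi> (outer u v) = h (f v)"
  shows "inj_on f L"
proof (rule inj_onI)
  fix x y assume xy: "x \<in> L" "y \<in> L" "f x = f y"
  then have "\<phi> (outer u x) = \<phi> (outer u y)" using eq by simp
  then have "outer u x = outer u y" using map_outer_eq_iff[OF u(1) xy(1) u(1) xy(2)] by simp
  then show "x = y" by (rule outer_left_cancel[OF _ L_carrier[OF xy(1)] L_carrier[OF xy(2)] u])
qed

lemma line_factor_obtain:
  assumes pl: preserves_lines and m: "0 < m" and v: "v \<in> L" "v \<noteq> 0\<^sub>v n"
  obtains A w where "A \<in> carrier_mat m m" "Rk A = m" "w \<in> carrier_vec n'" "w \<noteq> 0\<^sub>v n'"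
    "\<And>u. u \<in> carrier_vec m \<Longrightarrow> \<phi> (outer u v) = outer (A *\<^sub>v u) w"
proof -
  obtain g w where w: "w \<in> carrier_vec n'" and g: "\<And>u. u \<in> carrier_vec m \<Longrightarrow> g u \<in> carrier_vec m"
    and eq: "\<And>u. u \<in> carrier_vec m \<Longrightarrow> \<phi> (outer u v) = outer (g u) w"
    using preserves_lines_obtain[OF pl v(1)] by metis
  let ?e = "unit_vec m 0 :: 'a vec"
  have "?e \<noteq> 0\<^sub>v m" using m by simp
  then have "outer (g ?e) w \<noteq> 0\<^sub>m m n'"
    using map_outer_eq_zero_iff[OF unit_vec_carrier v(1), of 0] eq[of ?e] v(2) by simp
  then have w_nz: "w \<noteq> 0\<^sub>v n'" using g[of ?e] by auto
  obtain B where B: "B \<in> carrier_mat m m" "Rk B = min m m"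
    and gB: "\<And>u. u \<in> carrier_vec m \<Longrightarrow> g u = B\<^sup>T *\<^sub>v u"
    using full_rank_extension[OF subspace_carrier_vec
        linear_vec_on_left_factor[OF v(1) g w w_nz eq]
        inj_on_left_argument[where h = "\<lambda>a. outer a w", OF v eq]]
    by blast
  have "B\<^sup>T \<in> carrier_mat m m" "Rk (B\<^sup>T) = m" using B Rk_transpose_full[of B m] by auto
  then show ?thesis by (rule that[OF _ _ w w_nz]) (simp add: eq gB)
qed

lemma map_VL_line_eq:
  assumes v: "v \<in> L" and A: "A \<in> carrier_mat m m" "Rk A = m" and w: "w \<in> carrier_vec n'"
    and eq: "\<And>u. u \<in> carrier_vec m \<Longrightarrow> \<phi> (outer u v) = outer (A *\<^sub>v u) w"
  shows "\<phi> ` VL m n (line v) = VL m n' (line w)"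
proof -
  have "\<phi> ` VL m n (line v) = (\<lambda>u. \<phi> (outer u v)) ` carrier_vec m"
    by (simp add: VL_line[OF L_carrier[OF v]] image_image)
  also have "\<dots> = (\<lambda>u. outer (A *\<^sub>v u) w) ` carrier_vec m" using eq by (rule image_cong[OF refl])
  also have "\<dots> = (\<lambda>u. outer u w) ` (\<lambda>u. A *\<^sub>v u) ` carrier_vec m" by (simp add: image_image)
  finally show ?thesis unfolding image_mult_mat_vec_full_rank[OF A] VL_line[OF w] .
qed

lemma in_line_if_map_outer_in_line:
  assumes v: "v \<in> L" "v' \<in> L" and u: "u \<in> carrier_vec m" "u \<noteq> 0\<^sub>v m"
    and a: "a \<in> carrier_vec m" and w: "w \<in> carrier_vec n'" "w' \<in> line w"
    and image: "\<phi> ` VL m n (line v) = VL m n' (line w)" and eq: "\<phi> (outer u v') = outer a w'"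
  shows "v' \<in> line v"
proof -
  have "\<phi> (outer u v') \<in> \<phi> ` VL m n (line v)"
    unfolding image eq by (rule outer_in_VL[OF subspace_line[OF w(1)] a w(2)])
  then have "outer u v' \<in> VL m n (line v)"
    using inj_on_image_mem_iff[OF inj outer_in[OF u(1) v(2)] VL_mono[OF line_subset[OF L v(1)]]]
    by simp
  then show ?thesis by (rule in_subspace_if_outer_in_VL[OF subspace_line[OF L_carrier[OF v(1)]] u])
qed

lemma common_left_factor:
  assumes pl: preserves_lines and m: "0 < m" and v\<^sub>0: "v\<^sub>0 \<in> L" "v\<^sub>0 \<noteq> 0\<^sub>v n" and v: "v \<in> L"
    and A: "A \<in> carrier_mat m m" "Rk A = m" and w\<^sub>0: "w\<^sub>0 \<in> carrier_vec n'" "w\<^sub>0 \<noteq> 0\<^sub>v n'"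
    and eq\<^sub>0: "\<And>u. u \<in> carrier_vec m \<Longrightarrow> \<phi> (outer u v\<^sub>0) = outer (A *\<^sub>v u) w\<^sub>0"
  shows "\<exists>w\<in>carrier_vec n'. \<forall>u\<in>carrier_vec m. \<phi> (outer u v) = outer (A *\<^sub>v u) w"
proof (cases "v \<in> line v\<^sub>0")
  case True
  then obtain c where "v = c \<cdot>\<^sub>v v\<^sub>0" by (auto simp: in_line_iff)
  then have "\<phi> (outer u v) = outer (A *\<^sub>v u) (c \<cdot>\<^sub>v w\<^sub>0)" if "u \<in> carrier_vec m" for u
    using map_outer_smult_right[OF that v\<^sub>0(1)] eq\<^sub>0[OF that] by (simp add: outer_smult_right)
  then show ?thesis using w\<^sub>0(1) by (intro bexI[of _ "c \<cdot>\<^sub>v w\<^sub>0"]) auto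
next
  case False
  let ?e = "unit_vec m 0 :: 'a vec"
  have e: "?e \<in> carrier_vec m" "?e \<noteq> 0\<^sub>v m" using m by auto
  obtain g w where w: "w \<in> carrier_vec n'" and g: "\<And>u. u \<in> carrier_vec m \<Longrightarrow> g u \<in> carrier_vec m"
    and eq: "\<And>u. u \<in> carrier_vec m \<Longrightarrow> \<phi> (outer u v) = outer (g u) w"
    using preserves_lines_obtain[OF pl v] by metis
  obtain h y where y: "y \<in> carrier_vec n'" and h: "\<And>u. u \<in> carrier_vec m \<Longrightarrow> h u \<in> carrier_vec m"
    and eq_sum: "\<And>u. u \<in> carrier_vec m \<Longrightarrow> \<phi> (outer u (v\<^sub>0 + v)) = outer (h u) y"
    using preserves_lines_obtain[OF pl subspace_vec_add[OF L v\<^sub>0(1) v]] by metis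
  have image: "\<phi> ` VL m n (line v\<^sub>0) = VL m n' (line w\<^sub>0)"
    by (rule map_VL_line_eq[OF v\<^sub>0(1) A w\<^sub>0(1) eq\<^sub>0])
  have w_notin: "w \<notin> line w\<^sub>0"
    using in_line_if_map_outer_in_line[OF v\<^sub>0(1) v e g[OF e(1)] w\<^sub>0(1) _ image eq[OF e(1)]] False
    by blast
  obtain \<alpha> \<beta> where factors: "\<forall>a\<in>carrier_vec m. \<forall>c\<in>carrier_vec m. \<forall>x\<in>carrier_vec m.
      outer a w\<^sub>0 + outer c w = outer x y \<longrightarrow> a = \<alpha> \<cdot>\<^sub>v x \<and> c = \<beta> \<cdot>\<^sub>v x"
    using outer_add_outer_eq_outer[OF w\<^sub>0 w w_notin y] by blast
  have Ag: "A *\<^sub>v u = \<alpha> \<cdot>\<^sub>v h u" "g u = \<beta> \<cdot>\<^sub>v h u" if u: "u \<in> carrier_vec m" for u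
  proof -
    have "outer (A *\<^sub>v u) w\<^sub>0 + outer (g u) w = outer (h u) y"
      using map_outer_add_right[OF u v\<^sub>0(1) v] by (simp add: eq\<^sub>0[OF u] eq[OF u] eq_sum[OF u])
    then show "A *\<^sub>v u = \<alpha> \<cdot>\<^sub>v h u" "g u = \<beta> \<cdot>\<^sub>v h u"
      using factors mult_mat_vec_carrier[OF A(1) u] g[OF u] h[OF u] by blast+
  qed
  have "\<phi> (outer ?e v\<^sub>0) \<noteq> 0\<^sub>m m n'"
    using map_outer_eq_zero_iff[OF e(1) v\<^sub>0(1)] e(2) v\<^sub>0(2) by blast
  then have "\<alpha> \<noteq> 0" using Ag(1)[OF e(1)] eq\<^sub>0[OF e(1)] h[OF e(1)] w\<^sub>0(1) by auto
  then have "g u = (\<beta> / \<alpha>) \<cdot>\<^sub>v (A *\<^sub>v u)" if "u \<in> carrier_vec m" for u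
    using Ag[OF that] by (simp add: smult_smult_assoc)
  then have "\<phi> (outer u v) = outer (A *\<^sub>v u) ((\<beta> / \<alpha>) \<cdot>\<^sub>v w)" if "u \<in> carrier_vec m" for u
    using that by (simp add: eq outer_smult_left outer_smult_right)
  then show ?thesis using w by (intro bexI[of _ "(\<beta> / \<alpha>) \<cdot>\<^sub>v w"]) auto
qed

lemma eq_mult_on_VL_if_outer:
  assumes A: "A \<in> carrier_mat m m" and B: "B \<in> carrier_mat n n'"
    and outer: "\<And>u v. u \<in> carrier_vec m \<Longrightarrow> v \<in> L \<Longrightarrow> \<phi> (outer u v) = A * outer u v * B"
    and C: "C \<in> VL m n L"
  shows "\<phi> C = A * C * B"
proof -
  have add_mult: "A * (C + D) * B = A * C * B + A * D * B"
    if "C \<in> carrier_mat m n" "D \<in> carrier_mat m n" for C D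
    using mult_add_distrib_mat[OF A that]
      add_mult_distrib_mat[OF mult_carrier_mat[OF A that(1)] mult_carrier_mat[OF A that(2)] B]
    by simp
  have smult_mult: "A * (c \<cdot>\<^sub>m C) * B = c \<cdot>\<^sub>m (A * C * B)" if "C \<in> carrier_mat m n" for c C
    using mult_smult_distrib[OF A that] mult_smult_assoc_mat[OF mult_carrier_mat[OF A that] B]
    by simp
  have "subspace_mat m n {C \<in> VL m n L. \<phi> C = A * C * B}"
    using subspace_matD[OF subspace_VL[OF L, of m]] zero A B
    by (auto simp: subspace_mat_iff add smult subset_iff add_mult smult_mult)
  then have "VL m n L \<subseteq> {C \<in> VL m n L. \<phi> C = A * C * B}"
    using outer_in outer by (intro VL_subset_if_outer[OF L]) auto
  then show ?thesis using C by blast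
qed

lemma matrix_equivalence_if_common_left_factor:
  assumes A: "A \<in> carrier_mat m m" "Rk A = m" and m: "0 < m"
    and f: "\<And>v. v \<in> L \<Longrightarrow> f v \<in> carrier_vec n'"
    and eq: "\<And>u v. u \<in> carrier_vec m \<Longrightarrow> v \<in> L \<Longrightarrow> \<phi> (outer u v) = outer (A *\<^sub>v u) (f v)"
  shows "matrix_equivalence_on m n n' (VL m n L) \<phi>"
proof -
  let ?e = "unit_vec m 0 :: 'a vec"
  have e: "?e \<in> carrier_vec m" "?e \<noteq> 0\<^sub>v m" using m by auto
  have "det A \<noteq> 0" using A Rk_full_iff_det by blast
  then have Ae: "A *\<^sub>v ?e \<in> carrier_vec m" "A *\<^sub>v ?e \<noteq> 0\<^sub>v m"
    using A(1) det_0_iff_vec_prod_zero_field[OF A(1)] e by (simp, blast)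
  have f_lin: "linear_vec_on L n' f"
    using map_outer_add_right[OF e(1)] map_outer_smult_right[OF e(1)]
      subspace_vec_add[OF L] subspace_vec_smult[OF L]
    by (intro linear_vec_on_if_outer_left[OF L f Ae]) (simp_all flip: eq[OF e(1)])
  have f_inj: "inj_on f L"
    by (rule inj_on_right_argument[where h = "outer (A *\<^sub>v ?e)", OF e eq[OF e(1)]])
  obtain B where B: "B \<in> carrier_mat n n'" "Rk B = min n n'" "\<And>v. v \<in> L \<Longrightarrow> f v = B\<^sup>T *\<^sub>v v"
    using full_rank_extension[OF L f_lin f_inj] by blast
  have "\<phi> (outer u v) = A * outer u v * B" if "u \<in> carrier_vec m" "v \<in> L" for u v
    using mult_outer[OF A(1) that(1) B(1) L_carrier[OF that(2)]] eq[OF that] B(3)[OF that(2)]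
    by simp
  then show ?thesis
    using A B(1,2) eq_mult_on_VL_if_outer[OF A(1) B(1)] by (auto simp: matrix_equivalence_on_def)
qed

lemma matrix_equivalence_trivial:
  assumes trivial: "m = 0 \<or> L \<subseteq> {0\<^sub>v n}"
  shows "matrix_equivalence_on m n n' (VL m n L) \<phi>"
proof -
  have "linear_vec_on {0\<^sub>v n} n' (\<lambda>_. 0\<^sub>v n')" by (intro linear_vec_onI) auto
  then obtain B :: "'a mat" where B: "B \<in> carrier_mat n n'" "Rk B = min n n'"
    using full_rank_extension[OF subspace_zero_vec] by (metis inj_on_def singletonD)
  have "outer u v = 0\<^sub>m m n" if "u \<in> carrier_vec m" "v \<in> L" for u v
    using trivial that L_carrier[OF that(2)] by (auto simp: outer_eq_zero_iff)
  then have "\<phi> (outer u v) = 1\<^sub>m m * outer u v * B" if "u \<in> carrier_vec m" "v \<in> L" for u v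
    using that zero B(1) by simp
  then have "\<phi> C = 1\<^sub>m m * C * B" if "C \<in> VL m n L" for C
    using eq_mult_on_VL_if_outer[OF one_carrier_mat B(1) _ that] by blast
  moreover have "Rk (1\<^sub>m m :: 'a mat) = m" by (simp add: Rk_full_iff_det)
  ultimately show ?thesis using B one_carrier_mat unfolding matrix_equivalence_on_def by blast
qed

lemma matrix_equivalence_if_preserves_lines:
  assumes pl: preserves_lines
  shows "matrix_equivalence_on m n n' (VL m n L) \<phi>"
proof (cases "m = 0 \<or> L \<subseteq> {0\<^sub>v n}")
  case False
  then obtain v\<^sub>0 where m: "0 < m" and v\<^sub>0: "v\<^sub>0 \<in> L" "v\<^sub>0 \<noteq> 0\<^sub>v n" by blast
  obtain A w\<^sub>0 where A: "A \<in> carrier_mat m m" "Rk A = m"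
    and w\<^sub>0: "w\<^sub>0 \<in> carrier_vec n'" "w\<^sub>0 \<noteq> 0\<^sub>v n'"
    and eq\<^sub>0: "\<And>u. u \<in> carrier_vec m \<Longrightarrow> \<phi> (outer u v\<^sub>0) = outer (A *\<^sub>v u) w\<^sub>0"
    using line_factor_obtain[OF pl m v\<^sub>0] by metis
  obtain f where "\<And>v. v \<in> L \<Longrightarrow> f v \<in> carrier_vec n'"
    "\<And>u v. u \<in> carrier_vec m \<Longrightarrow> v \<in> L \<Longrightarrow> \<phi> (outer u v) = outer (A *\<^sub>v u) (f v)"
    using common_left_factor[OF pl m v\<^sub>0 _ A w\<^sub>0 eq\<^sub>0] by metis
  then show ?thesis by (rule matrix_equivalence_if_common_left_factor[OF A m])
qed (rule matrix_equivalence_trivial)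

lemma map_VL_line_eq_if_preserves_rank_supports:
  assumes supports: "preserves_rank_supports m n n' (VL m n L) \<phi>" and m: "0 < m"
    and v: "v \<in> L" and w: "w \<in> carrier_vec n'" "w \<noteq> 0\<^sub>v n'"
    and sub: "VL m n' (line w) \<subseteq> \<phi> ` VL m n (line v)"
  shows "\<phi> ` VL m n (line v) = VL m n' (line w)"
proof -
  have V_sub: "VL m n (line v) \<subseteq> VL m n L" by (rule VL_mono[OF line_subset[OF L v]])
  have lw: "subspace_vec n' (line w)" by (rule subspace_line[OF w(1)])
  define U where "U = {C \<in> VL m n L. \<phi> C \<in> VL m n' (line w)}"
  have image_U: "\<phi> ` U = VL m n' (line w)" using sub V_sub unfolding U_def by blast
  have U_sub: "U \<subseteq> VL m n (line v)"
    using sub inj_on_image_mem_iff[OF inj _ V_sub] unfolding U_def by blast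
  have "subspace_mat m n U" "U \<subseteq> VL m n L"
    unfolding U_def by (rule subspace_mat_vimage[OF subspace_VL[OF lw]], blast)
  then have "rank_support_space m n U"
    using rank_support_space_VL[OF lw, of m]
    by (simp add: preserves_rank_supportsD[OF supports] image_U)
  then have "U = {0\<^sub>m m n} \<or> U = VL m n (line v)"
    by (rule rank_support_space_subset_VL_line[OF _ U_sub L_carrier[OF v]])
  moreover have "U \<noteq> {0\<^sub>m m n}"
  proof
    assume "U = {0\<^sub>m m n}"
    then have "VL m n' (line w) \<subseteq> VL m n' {0\<^sub>v n'}" using image_U by (auto simp: VL_zero zero)
    then have "line w \<subseteq> {0\<^sub>v n'}" using m unfolding VL_subset_iff[OF lw subspace_zero_vec] by simp
    then show False using w(2) self_in_line by blast
  qed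
  ultimately show ?thesis using image_U by blast
qed

lemma preserves_lines_if_rank_supports:
  assumes supports: "preserves_rank_supports m n n' (VL m n L) \<phi>"
  shows preserves_lines
  unfolding preserves_lines_def
proof
  fix v assume v: "v \<in> L"
  have lv: "subspace_vec n (line v)" by (rule subspace_line[OF L_carrier[OF v]])
  have "VL m n (line v) \<subseteq> VL m n L" by (rule VL_mono[OF line_subset[OF L v]])
  then have "rank_support_space m n' (\<phi> ` VL m n (line v))"
    using preserves_rank_supportsD[OF supports subspace_VL[OF lv]] rank_support_space_VL[OF lv]
    by simp
  then obtain S where S: "subspace_vec n' S" and image: "\<phi> ` VL m n (line v) = VL m n' S"
    by (auto simp: rank_support_space_def)
  show "\<exists>w\<in>carrier_vec n'. \<phi> ` VL m n (line v) \<subseteq> VL m n' (line w)"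
  proof (cases "m = 0 \<or> S \<subseteq> {0\<^sub>v n'}")
    case True
    then show ?thesis
      unfolding image
      by (intro bexI[of _ "0\<^sub>v n'"]) (simp_all add: line_zero VL_subset_iff S subspace_zero_vec)
  next
    case False
    then obtain w where w: "w \<in> S" "w \<noteq> 0\<^sub>v n'" and m: "0 < m" by blast
    have wc: "w \<in> carrier_vec n'" by (rule subspace_vec_carrierD[OF S w(1)])
    have "VL m n' (line w) \<subseteq> \<phi> ` VL m n (line v)"
      unfolding image by (rule VL_mono[OF line_subset[OF S w(1)]])
    then have "\<phi> ` VL m n (line v) = VL m n' (line w)"
      by (rule map_VL_line_eq_if_preserves_rank_supports[OF supports m v wc w(2)])
    then show ?thesis using wc by blast
  qed
qed

lemma preserves_lines_if_weights:
  assumes weights: "preserves_weights m n n' (VL m n L) \<phi>"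
  shows preserves_lines
  unfolding preserves_lines_def
proof
  fix v assume v: "v \<in> L"
  let ?V = "VL m n (line v)"
  have V_sub: "?V \<subseteq> VL m n L" by (rule VL_mono[OF line_subset[OF L v]])
  have "wtR n ?V \<le> 1" using wtR_le_1_iff[OF VL_subset_carrier] L_carrier[OF v] by blast
  moreover have "wtR n' (\<phi> ` ?V) = wtR n ?V"
    by (rule preserves_weightsD[OF weights subspace_VL[OF subspace_line[OF L_carrier[OF v]]] V_sub])
  moreover have "\<phi> ` ?V \<subseteq> carrier_mat m n'" using maps_carrier V_sub by blast
  ultimately show "\<exists>w\<in>carrier_vec n'. \<phi> ` ?V \<subseteq> VL m n' (line w)" using wtR_le_1_iff by metis
qed

lemma preserves_rank_if_weights:
  assumes weights: "preserves_weights m n n' (VL m n L) \<phi>"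
  shows "preserves_rank (VL m n L) \<phi>"
  unfolding preserves_rank_def
proof
  fix C assume C: "C \<in> VL m n L"
  let ?D = "range (\<lambda>c. c \<cdot>\<^sub>m C)"
  have Cc: "C \<in> carrier_mat m n" using C by (simp add: VL_def)
  have "?D \<subseteq> VL m n L" using subspace_mat_smult[OF subspace_VL[OF L] C] by blast
  then have "wtR n' (\<phi> ` ?D) = wtR n ?D"
    by (rule preserves_weightsD[OF weights subspace_range_smult[OF Cc]])
  moreover have "\<phi> ` ?D = range (\<lambda>c. c \<cdot>\<^sub>m \<phi> C)" using smult[OF C] by (auto simp: image_image)
  ultimately show "Rk (\<phi> C) = Rk C"
    using wtR_range_smult[OF Cc] wtR_range_smult[OF maps_carrier[OF C]] by simp
qed

context
  fixes A B :: "'a mat"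
  assumes A: "A \<in> carrier_mat m m" "Rk A = m" and B: "B \<in> carrier_mat n n'"
    and eq: "\<And>C. C \<in> VL m n L \<Longrightarrow> \<phi> C = A * C * B"
begin

lemma linear_transpose_mult: "S \<subseteq> L \<Longrightarrow> linear_vec_on S n' (\<lambda>x. B\<^sup>T *\<^sub>v x)"
  using B subspace_vec_subset_carrier[OF L] by (intro linear_vec_on_mult_mat_vec) auto

lemma Row_map: "C \<in> VL m n L \<Longrightarrow> Row (\<phi> C) = (\<lambda>x. B\<^sup>T *\<^sub>v x) ` Row C"
  using Row_mult[OF A _ B] eq by (simp add: VL_def)

lemma image_VL:
  assumes S: "subspace_vec n S" and SL: "S \<subseteq> L"
  shows "\<phi> ` VL m n S = VL m n' ((\<lambda>x. B\<^sup>T *\<^sub>v x) ` S)"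
proof
  have VS: "VL m n S \<subseteq> VL m n L" by (rule VL_mono[OF SL])
  show "\<phi> ` VL m n S \<subseteq> VL m n' ((\<lambda>x. B\<^sup>T *\<^sub>v x) ` S)"
  proof (rule image_subsetI)
    fix C assume C: "C \<in> VL m n S"
    then have "C \<in> VL m n L" using VS by blast
    then show "\<phi> C \<in> VL m n' ((\<lambda>x. B\<^sup>T *\<^sub>v x) ` S)"
      using C Row_map maps_carrier by (auto simp: VL_def)
  qed
  have "outer u (B\<^sup>T *\<^sub>v s) \<in> \<phi> ` VL m n S" if u: "u \<in> carrier_vec m" and s: "s \<in> S" for u s
  proof -
    have "u \<in> (\<lambda>x. A *\<^sub>v x) ` carrier_vec m" by (simp only: u image_mult_mat_vec_full_rank[OF A])
    then obtain u' where u': "u = A *\<^sub>v u'" "u' \<in> carrier_vec m" by (rule imageE)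
    have in_S: "outer u' s \<in> VL m n S" by (rule outer_in_VL[OF S u'(2) s])
    then have "outer u' s \<in> VL m n L" using VS by blast
    then have "\<phi> (outer u' s) = outer u (B\<^sup>T *\<^sub>v s)"
      unfolding u'(1) mult_outer[OF A(1) u'(2) B subspace_vec_carrierD[OF S s], symmetric]
      by (rule eq)
    then show ?thesis using in_S by (metis imageI)
  qed
  then show "VL m n' ((\<lambda>x. B\<^sup>T *\<^sub>v x) ` S) \<subseteq> \<phi> ` VL m n S"
    using subspace_mat_image[OF subspace_VL[OF S] VS]
    by (intro VL_subset_if_outer[OF subspace_vec_image[OF S linear_transpose_mult[OF SL]]]) auto
qed

lemma preserves_rank_supports_if_equivalence: "preserves_rank_supports m n n' (VL m n L) \<phi>"
  unfolding preserves_rank_supports_def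
proof (intro allI impI, elim conjE)
  fix U assume U: "subspace_mat m n U" "U \<subseteq> VL m n L"
  show "rank_support_space m n U \<longleftrightarrow> rank_support_space m n' (\<phi> ` U)"
  proof
    assume "rank_support_space m n U"
    then obtain S where S: "subspace_vec n S" "U = VL m n S" by (auto simp: rank_support_space_def)
    have T: "subspace_vec n (S \<inter> L)"
      using subspace_vecD[OF S(1)] subspace_vecD[OF L] by (auto simp: subspace_vec_iff)
    have "U = VL m n (S \<inter> L)" using U S by (auto simp: VL_def)
    then show "rank_support_space m n' (\<phi> ` U)"
      using image_VL[OF T] rank_support_space_VL[OF subspace_vec_image[OF T linear_transpose_mult]]
      by simp
  next
    assume "rank_support_space m n' (\<phi> ` U)"
    then obtain S where S: "subspace_vec n' S" "\<phi> ` U = VL m n' S"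
      by (auto simp: rank_support_space_def)
    have "C \<in> U \<longleftrightarrow> C \<in> VL m n {x \<in> L. B\<^sup>T *\<^sub>v x \<in> S}" for C
    proof -
      have "C \<in> U \<longleftrightarrow> C \<in> VL m n L \<and> \<phi> C \<in> VL m n' S"
        using inj_on_image_mem_iff[OF inj _ U(2)] U(2) S(2) by blast
      also have "\<dots> \<longleftrightarrow> C \<in> VL m n L \<and> (\<lambda>x. B\<^sup>T *\<^sub>v x) ` Row C \<subseteq> S"
        using Row_map maps_carrier by (auto simp: VL_def)
      also have "\<dots> \<longleftrightarrow> C \<in> VL m n {x \<in> L. B\<^sup>T *\<^sub>v x \<in> S}" by (auto simp: VL_def)
      finally show ?thesis .
    qed
    then have "U = VL m n {x \<in> L. B\<^sup>T *\<^sub>v x \<in> S}" by blast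
    then show "rank_support_space m n U"
      using rank_support_space_VL[OF subspace_vec_vimage[OF L linear_transpose_mult S(1)]] by simp
  qed
qed

lemma inj_on_transpose_mult:
  assumes m: "0 < m"
  shows "inj_on (\<lambda>x. B\<^sup>T *\<^sub>v x) L"
proof -
  let ?e = "unit_vec m 0 :: 'a vec"
  have e: "?e \<in> carrier_vec m" "?e \<noteq> 0\<^sub>v m" using m by auto
  have "\<phi> (outer ?e v) = outer (A *\<^sub>v ?e) (B\<^sup>T *\<^sub>v v)" if "v \<in> L" for v
    using eq[OF outer_in[OF e(1) that]] mult_outer[OF A(1) e(1) B L_carrier[OF that]] by simp
  then show ?thesis by (rule inj_on_right_argument[where h = "outer (A *\<^sub>v ?e)", OF e])
qed

lemma preserves_weights_if_equivalence: "preserves_weights m n n' (VL m n L) \<phi>"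
  unfolding preserves_weights_def
proof (intro allI impI, elim conjE)
  fix D assume D: "D \<subseteq> VL m n L"
  have Dc: "D \<subseteq> carrier_mat m n" using D VL_subset_carrier by blast
  have "\<phi> ` D = (\<lambda>C. A * C * B) ` D" using eq D by (intro image_cong) auto
  then have supp: "RSupp n' (\<phi> ` D) = (\<lambda>x. B\<^sup>T *\<^sub>v x) ` RSupp n D"
    using RSupp_image_mult[OF A B Dc] by simp
  have sub: "RSupp n D \<subseteq> L" using RSupp_subset_iff[OF Dc L] D by blast
  have "inj_on (\<lambda>x. B\<^sup>T *\<^sub>v x) (RSupp n D)"
  proof (cases "m = 0")
    case True
    then have "D \<subseteq> VL m n {0\<^sub>v n}" using Dc by (auto simp: VL_iff_rows[OF subspace_zero_vec])
    then have "RSupp n D \<subseteq> {0\<^sub>v n}" using RSupp_subset_iff[OF Dc subspace_zero_vec] by blast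
    then show ?thesis by (auto intro: inj_on_subset)
  next
    case False
    then show ?thesis using inj_on_subset[OF inj_on_transpose_mult sub] by blast
  qed
  then show "wtR n' (\<phi> ` D) = wtR n D"
    using dim_vec_image[OF subspace_RSupp[OF Dc] linear_transpose_mult[OF sub]] supp
    by (simp add: wtR_def)
qed

end

lemma le_if_map_outer_common_column:
  assumes v: "v \<in> L" "v \<noteq> 0\<^sub>v n" and w: "w \<in> carrier_vec m"
    and column: "\<And>u. u \<in> carrier_vec m \<Longrightarrow> \<exists>b\<in>carrier_vec n'. \<phi> (outer u v) = outer w b"
  shows "m \<le> n'"
proof (cases "m = 0")
  case False
  obtain g where g: "\<And>u. u \<in> carrier_vec m \<Longrightarrow> g u \<in> carrier_vec n'"
    and eq: "\<And>u. u \<in> carrier_vec m \<Longrightarrow> \<phi> (outer u v) = outer w (g u)" using column by metis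
  let ?e = "unit_vec m 0 :: 'a vec"
  have e: "?e \<in> carrier_vec m" "?e \<noteq> 0\<^sub>v m" using False by auto
  have "outer w (g ?e) \<noteq> 0\<^sub>m m n'"
    using map_outer_eq_zero_iff[OF e(1) v(1)] e(2) v(2) eq[OF e(1)] by simp
  then have "w \<noteq> 0\<^sub>v m" using g[OF e(1)] by auto
  then have g_lin: "linear_vec_on (carrier_vec m) n' g"
    using linear_vec_on_right_factor[OF v(1) g w _ eq] by blast
  have "inj_on g (carrier_vec m)" by (rule inj_on_left_argument[where h = "outer w", OF v eq])
  then have "dim_vec n' (g ` carrier_vec m) = m"
    using dim_vec_image[OF subspace_carrier_vec g_lin] by (simp add: dim_carrier_vec)
  then show ?thesis using dim_vec_le[OF subspace_vec_image[OF subspace_carrier_vec g_lin]] by simp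
qed simp

lemma preserves_lines_if_rank_le_1:
  assumes less: "n' < m" and rank: "\<And>C. C \<in> VL m n L \<Longrightarrow> Rk C \<le> 1 \<Longrightarrow> Rk (\<phi> C) \<le> 1"
  shows preserves_lines
  unfolding preserves_lines_def
proof
  fix v assume v: "v \<in> L"
  have vc: "v \<in> carrier_vec n" by (rule L_carrier[OF v])
  have V_sub: "VL m n (line v) \<subseteq> VL m n L" by (rule VL_mono[OF line_subset[OF L v]])
  have "subspace_mat m n' (\<phi> ` VL m n (line v))"
    by (rule subspace_mat_image[OF subspace_VL[OF subspace_line[OF vc]] V_sub])
  moreover have "Rk D \<le> 1" if D: "D \<in> \<phi> ` VL m n (line v)" for D
  proof -
    obtain C where C: "C \<in> VL m n (line v)" "D = \<phi> C" using D by blast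
    then have "Rk C \<le> 1" using vc in_VL_line_iff[OF vc] Rk_le_1_iff VL_subset_carrier by blast
    then show ?thesis using rank C V_sub by blast
  qed
  ultimately consider (row) w where "w \<in> carrier_vec n'" "\<phi> ` VL m n (line v) \<subseteq> VL m n' (line w)"
    | (column) w where "w \<in> carrier_vec m" "transpose_mat ` \<phi> ` VL m n (line v) \<subseteq> VL n' m (line w)"
    by (rule rank_le_1_subspace_cases)
  then show "\<exists>w\<in>carrier_vec n'. \<phi> ` VL m n (line v) \<subseteq> VL m n' (line w)"
  proof cases
    case (column w)
    have "\<exists>b\<in>carrier_vec n'. \<phi> (outer u v) = outer w b" if u: "u \<in> carrier_vec m" for u
    proof -
      have "(\<phi> (outer u v))\<^sup>T \<in> VL n' m (line w)"
        using column(2) outer_in_VL[OF subspace_line[OF vc] u self_in_line] by blast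
      then obtain b where "b \<in> carrier_vec n'" "(\<phi> (outer u v))\<^sup>T = outer b w"
        using in_VL_line_iff[OF column(1)] by blast
      then show ?thesis by (metis transpose_outer transpose_transpose)
    qed
    then have "v = 0\<^sub>v n" using le_if_map_outer_common_column[OF v _ column(1)] less by force
    then have "\<phi> ` VL m n (line v) = VL m n' (line (0\<^sub>v n'))" by (simp add: line_zero VL_zero zero)
    then show ?thesis by (intro bexI[of _ "0\<^sub>v n'"]) simp_all
  qed blast
qed

end

section \<open>Rank isometries\<close>

lemma transpose_smult: "(c \<cdot>\<^sub>m C)\<^sup>T = c \<cdot>\<^sub>m C\<^sup>T"
  by (intro eq_matI) auto

lemma rank_support_embedding_transpose:
  assumes embedding: "rank_support_embedding m n n (carrier_vec n) \<phi>"
  shows "rank_support_embedding n m m (carrier_vec m) (\<lambda>C. (\<phi> (C\<^sup>T))\<^sup>T)"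
proof -
  interpret rank_support_embedding m n n "carrier_vec n" \<phi> by (rule embedding)
  note maps = maps_carrier[unfolded VL_carrier_vec]
  show ?thesis
  proof (unfold_locales, unfold VL_carrier_vec)
    fix C D :: "'a mat" assume "C \<in> carrier_mat n m" "D \<in> carrier_mat n m"
    then have CD: "C\<^sup>T \<in> carrier_mat m n" "D\<^sup>T \<in> carrier_mat m n" and "(C + D)\<^sup>T = C\<^sup>T + D\<^sup>T"
      by (auto simp: transpose_add[where nr = n and nc = m])
    then show "(\<phi> ((C + D)\<^sup>T))\<^sup>T = (\<phi> (C\<^sup>T))\<^sup>T + (\<phi> (D\<^sup>T))\<^sup>T"
      using transpose_add[OF maps[OF CD(1)] maps[OF CD(2)]] add CD by (simp add: VL_carrier_vec)
  next
    fix c and C :: "'a mat" assume "C \<in> carrier_mat n m"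
    then show "(\<phi> ((c \<cdot>\<^sub>m C)\<^sup>T))\<^sup>T = c \<cdot>\<^sub>m (\<phi> (C\<^sup>T))\<^sup>T"
      using smult[of "C\<^sup>T"] by (simp add: VL_carrier_vec transpose_smult)
  next
    fix C :: "'a mat" assume "C \<in> carrier_mat n m"
    then show "(\<phi> (C\<^sup>T))\<^sup>T \<in> carrier_mat n m" using maps[of "C\<^sup>T"] by simp
  next
    show "inj_on (\<lambda>C. (\<phi> (C\<^sup>T))\<^sup>T) (carrier_mat n m)"
    proof (rule inj_onI)
      fix C D :: "'a mat" assume CD: "C \<in> carrier_mat n m" "D \<in> carrier_mat n m"
        and eq: "(\<phi> (C\<^sup>T))\<^sup>T = (\<phi> (D\<^sup>T))\<^sup>T"
      have "\<phi> (C\<^sup>T) = \<phi> (D\<^sup>T)" using arg_cong[OF eq, of transpose_mat] by simp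
      then have "C\<^sup>T = D\<^sup>T" using inj CD by (simp add: VL_carrier_vec inj_on_eq_iff)
      then show "C = D" by (metis transpose_transpose)
    qed
  qed (rule subspace_carrier_vec)
qed

lemma matrix_equivalence_transpose:
  assumes "matrix_equivalence_on n m m (carrier_mat n m) (\<lambda>C. (\<phi> (C\<^sup>T))\<^sup>T)"
  shows "matrix_equivalence_on m n n (carrier_mat m n) \<phi>"
proof -
  obtain A B where A: "A \<in> carrier_mat n n" "Rk A = n" and B: "B \<in> carrier_mat m m" "Rk B = m"
    and eq: "\<And>C. C \<in> carrier_mat n m \<Longrightarrow> (\<phi> (C\<^sup>T))\<^sup>T = A * C * B"
    using assms by (auto simp: matrix_equivalence_on_def)
  have "\<phi> C = B\<^sup>T * C * A\<^sup>T" if C: "C \<in> carrier_mat m n" for C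
  proof -
    have CT: "C\<^sup>T \<in> carrier_mat n m" and AT: "A\<^sup>T \<in> carrier_mat n n" and BT: "B\<^sup>T \<in> carrier_mat m m"
      using A B C by auto
    have "\<phi> C = (A * C\<^sup>T * B)\<^sup>T" using eq[OF CT] by (metis transpose_transpose)
    also have "\<dots> = B\<^sup>T * (C * A\<^sup>T)"
      using transpose_mult[OF mult_carrier_mat[OF A(1) CT] B(1)] transpose_mult[OF A(1) CT] by simp
    also have "\<dots> = B\<^sup>T * C * A\<^sup>T" by (rule assoc_mult_mat[OF BT C AT, symmetric])
    finally show ?thesis .
  qed
  then show ?thesis
    unfolding matrix_equivalence_on_def using A B Rk_transpose_full
    by (intro bexI[of _ "B\<^sup>T"] bexI[of _ "A\<^sup>T"]) auto
qed

lemma matrix_equivalence_if_preserves_rank: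
  assumes embedding: "rank_support_embedding m n n (carrier_vec n) \<phi>" and "m \<noteq> n"
    and rank: "preserves_rank (carrier_mat m n) \<phi>"
  shows "matrix_equivalence_on m n n (carrier_mat m n) \<phi>"
proof -
  interpret rank_support_embedding m n n "carrier_vec n" \<phi> by (rule embedding)
  have rank_le_1: "Rk (\<phi> C) \<le> 1" if "C \<in> carrier_mat m n" "Rk C \<le> 1" for C
    using rank that by (simp add: preserves_rank_def)
  consider (tall) "n < m" | (wide) "m < n" using \<open>m \<noteq> n\<close> by linarith
  then show ?thesis
  proof cases
    case tall
    then show ?thesis
      using matrix_equivalence_if_preserves_lines preserves_lines_if_rank_le_1 rank_le_1
      unfolding VL_carrier_vec by blast
  next
    case wide
    interpret T: rank_support_embedding n m m "carrier_vec m" "\<lambda>C. (\<phi> (C\<^sup>T))\<^sup>T"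
      by (rule rank_support_embedding_transpose[OF embedding])
    have "Rk ((\<phi> (C\<^sup>T))\<^sup>T) \<le> 1" if C: "C \<in> carrier_mat n m" "Rk C \<le> 1" for C
    proof -
      have CT: "C\<^sup>T \<in> carrier_mat m n" using C(1) by simp
      then have "\<phi> (C\<^sup>T) \<in> carrier_mat m n" using maps_carrier by (simp add: VL_carrier_vec)
      then show ?thesis by (rule Rk_transpose_le_1[OF _ rank_le_1[OF CT Rk_transpose_le_1[OF C]]])
    qed
    then have "matrix_equivalence_on n m m (carrier_mat n m) (\<lambda>C. (\<phi> (C\<^sup>T))\<^sup>T)"
      using T.matrix_equivalence_if_preserves_lines T.preserves_lines_if_rank_le_1 wide
      unfolding VL_carrier_vec by blast
    then show ?thesis by (rule matrix_equivalence_transpose)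
  qed
qed

theorem theorem4:
  fixes m n n' :: nat
    and L :: "'a::field vec set" and L' :: "'a vec set"
    and \<V> \<W> :: "'a mat set"
    and \<phi> :: "'a mat \<Rightarrow> 'a mat"
  assumes L: "subspace_vec n L" and L': "subspace_vec n' L'"
    and V: "\<V> = VL m n L" and W: "\<W> = VL m n' L'"
    and add: "\<And>C D. C \<in> \<V> \<Longrightarrow> D \<in> \<V> \<Longrightarrow> \<phi> (C + D) = \<phi> C + \<phi> D"
    and smult: "\<And>a C. C \<in> \<V> \<Longrightarrow> \<phi> (a \<cdot>\<^sub>m C) = a \<cdot>\<^sub>m \<phi> C"
    and bij: "bij_betw \<phi> \<V> \<W>"
  defines "P1 \<equiv> (\<exists>A \<in> carrier_mat m m. \<exists>B \<in> carrier_mat n n'.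
                   Rk A = m \<and> Rk B = min n n' \<and> (\<forall>C \<in> \<V>. \<phi> C = A * C * B))"
    and "P2 \<equiv> (\<forall>\<U>. subspace_mat m n \<U> \<and> \<U> \<subseteq> \<V> \<longrightarrow>
                   (rank_support_space m n \<U> \<longleftrightarrow> rank_support_space m n' (\<phi> ` \<U>)))"
    and "P3 \<equiv> (\<forall>\<D>. subspace_mat m n \<D> \<and> \<D> \<subseteq> \<V> \<longrightarrow> wtR n' (\<phi> ` \<D>) = wtR n \<D>)"
    and "P4 \<equiv> (\<forall>C \<in> \<V>. Rk (\<phi> C) = Rk C)"
  shows "(P1 \<longleftrightarrow> P2) \<and> (P2 \<longleftrightarrow> P3) \<and> (P3 \<longrightarrow> P4)
         \<and> (\<V> = carrier_mat m n \<and> \<W> = carrier_mat m n' \<and> n' = n \<and> m \<noteq> n \<longrightarrow> (P4 \<longrightarrow> P1))"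
proof -
  interpret rank_support_embedding m n n' L \<phi>
  proof
    show "\<phi> C \<in> carrier_mat m n'" if "C \<in> VL m n L" for C
      using bij_betwE[OF bij] that VL_subset_carrier unfolding V W by blast
  qed (use L add smult bij in \<open>auto simp: V bij_betw_def\<close>)
  have P1: "P1 \<longleftrightarrow> matrix_equivalence_on m n n' \<V> \<phi>"
    and P2: "P2 \<longleftrightarrow> preserves_rank_supports m n n' \<V> \<phi>"
    and P3: "P3 \<longleftrightarrow> preserves_weights m n n' \<V> \<phi>"
    and P4: "P4 \<longleftrightarrow> preserves_rank \<V> \<phi>"
    by (simp_all only: P1_def P2_def P3_def P4_def matrix_equivalence_on_def
        preserves_rank_supports_def preserves_weights_def preserves_rank_def)
  have "P1 \<Longrightarrow> P2" "P1 \<Longrightarrow> P3"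
    using preserves_rank_supports_if_equivalence preserves_weights_if_equivalence
    unfolding P1 P2 P3 V matrix_equivalence_on_def by blast+
  moreover have "P2 \<Longrightarrow> P1" "P3 \<Longrightarrow> P1"
    using preserves_lines_if_rank_supports preserves_lines_if_weights
      matrix_equivalence_if_preserves_lines unfolding P1 P2 P3 V by blast+
  moreover have "P3 \<Longrightarrow> P4"
    using preserves_rank_if_weights unfolding P3 P4 V by blast
  moreover have P1 if full: "\<V> = carrier_mat m n" "n' = n" and "m \<noteq> n" P4
  proof -
    have "rank_support_embedding m n n (carrier_vec n) \<phi>"
      using rank_support_embedding_axioms full subspace_carrier_vec
      by (simp add: rank_support_embedding_def VL_carrier_vec flip: V)
    then show P1
      using matrix_equivalence_if_preserves_rank \<open>m \<noteq> n\<close> \<open>P4\<close> unfolding P1 P4 full by blast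
  qed
  ultimately show ?thesis by blast
qed

end
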